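(* Let $N\geq 3$ and let $f$ satisfy the standing assumptions stated in the context. If $(u_{k})$ is a bounded sequence in $D^{1,2}(\mathbb{R}^{N})$ and there exists $R>0$ such that $$\lim_{k\to\infty}\left(\sup_{y\in\mathbb{R}^{N}}\int_{B_{R}(y)}|u_{k}|^{2}\right)=0,$$ then $\lim_{k\to\infty}\int_{\mathbb{R}^{N}}f(u_{k})u_{k}=0$.
   Context: $2^{*}:=\frac{2N}{N-2}$; $D^{1,2}(\mathbb{R}^{N}):=\{u\in L^{2^{*}}(\mathbb{R}^{N}):\nabla u\in L^{2}(\mathbb{R}^{N},\mathbb{R}^{N})\}$ with norm $\|u\|:=(\int_{\mathbb{R}^N}|\nabla u|^2)^{1/2}$; $B_R(y):=\{x\in\mathbb{R}^N:|x-y|<R\}$. Standing assumptions on $f:[0,\infty)\to\mathbb{R}$, with $F(s):=\int_0^s f(t)\,dt$: (f1) $f\in\mathcal{C}^{1}[0,\infty)$, and there are constants $A_{1}>0$ and $2<p<2^{*}<q$ such that, for $m=-1,0,1$, $|f^{(m)}(s)|\leq A_{1}|s|^{p-(m+1)}$ if $|s|\geq 1$ and $|f^{(m)}(s)|\leq A_{1}|s|^{q-(m+1)}$ if $|s|\leq 1$, where $f^{(-1)}:=F$, $f^{(0)}:=f$, $f^{(1)}:=f'$. (f2) There is $\theta>2$ such that $0\leq\theta F(s)\leq f(s)s<f'(s)s^{2}$ for all $s>0$. (f3) $g(s):=\frac{sf'(s)}{f(s)}$ is a decreasing function of $s>0$ and $\lim_{s\to\infty}g(s)<2^{*}-1<\lim_{s\to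 0}g(s)$. The function $f$ is extended to an odd $\mathcal{C}^1$ function on $\mathbb{R}$ by $f(u):=-f(-u)$ for $u<0$, still denoted $f$. *)

theory Defs
  imports "HOL-Analysis.Analysis"
begin

subsection \<open>The space \<open>D\<^sup>1\<^sup>,\<^sup>2\<close>\<close>

text \<open>\<open>2\<^sup>*\<close>, meaningful for \<open>N \<ge> 3\<close>.\<close>

definition crit_exp :: "nat \<Rightarrow> real" where
  "crit_exp N = 2 * real N / (real N - 2)"

text \<open>Functions rather than a.e. classes; measurability is with respect to the Lebesgue
  \<open>\<sigma>\<close>-algebra and is not implied by integrability of the power.\<close>

definition Lp_space :: "real \<Rightarrow> ('a::euclidean_space \<Rightarrow> 'b::euclidean_space) set" where
  "Lp_space r = {u. u \<in> borel_measurable lebesgue \<and> integrable lebesgue (\<lambda>x. norm (u x) powr r)}"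

definition locally_integrable :: "('a::euclidean_space \<Rightarrow> 'b::euclidean_space) \<Rightarrow> bool" where
  "locally_integrable u \<longleftrightarrow> (\<forall>K. compact K \<longrightarrow> set_integrable lebesgue K u)"

primrec Ck :: "nat \<Rightarrow> ('a::euclidean_space \<Rightarrow> real) \<Rightarrow> bool" where
  "Ck 0 \<phi> \<longleftrightarrow> continuous_on UNIV \<phi>"
| "Ck (Suc k) \<phi> \<longleftrightarrow>
     (\<forall>x. \<phi> differentiable (at x)) \<and> (\<forall>i\<in>Basis. Ck k (\<lambda>x. frechet_derivative \<phi> (at x) i))"

definition test_function :: "('a::euclidean_space \<Rightarrow> real) \<Rightarrow> bool" where
  "test_function \<phi> \<longleftrightarrow> (\<forall>k. Ck k \<phi>) \<and> compact (closure {x. \<phi> x \<noteq> 0})"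

definition weak_gradient :: "('a::euclidean_space \<Rightarrow> real) \<Rightarrow> ('a \<Rightarrow> 'a) \<Rightarrow> bool" where
  "weak_gradient u G \<longleftrightarrow> locally_integrable u \<and> locally_integrable G \<and>
     (\<forall>\<phi>. test_function \<phi> \<longrightarrow> (\<forall>i\<in>Basis.
        (LINT x|lebesgue. u x * frechet_derivative \<phi> (at x) i)
        = - (LINT x|lebesgue. (G x \<bullet> i) * \<phi> x)))"

definition D12 :: "('a::euclidean_space \<Rightarrow> real) set" where
  "D12 = {u. u \<in> Lp_space (crit_exp DIM('a)) \<and> (\<exists>G. weak_gradient u G \<and> G \<in> Lp_space 2)}"

text \<open>Weak gradients are unique up to null sets, so the norm below does not depend on the choice.\<close>

definition D12_grad :: "('a::euclidean_space \<Rightarrow> real) \<Rightarrow> 'a \<Rightarrow> 'a" where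
  "D12_grad u = (SOME G. weak_gradient u G \<and> G \<in> Lp_space 2)"

definition D12_norm :: "('a::euclidean_space \<Rightarrow> real) \<Rightarrow> real" where
  "D12_norm u = sqrt (LINT x|lebesgue. (norm (D12_grad u x))\<^sup>2)"

subsection \<open>The nonlinearity\<close>

text \<open>A function on \<open>[0,\<infinity>)\<close> is a total function on the reals of which only the values on
  \<open>[0,\<infinity>)\<close> are used; \<open>f'\<close> is its derivative there, one-sided at \<open>0\<close>.\<close>

definition C1_halfline :: "(real \<Rightarrow> real) \<Rightarrow> (real \<Rightarrow> real) \<Rightarrow> bool" where
  "C1_halfline f f' \<longleftrightarrow>
     (\<forall>s\<ge>0. (f has_real_derivative f' s) (at s within {0..})) \<and> continuous_on {0..} f'"

definition primitive :: "(real \<Rightarrow> real) \<Rightarrow> real \<Rightarrow> real" where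
  "primitive f s = integral {0..s} f"

text \<open>At \<open>s = 0\<close> the convention \<open>0 powr a = 0\<close> agrees with the usual power, since all
  exponents \<open>q - (m + 1)\<close> are positive.\<close>

definition f1 :: "nat \<Rightarrow> (real \<Rightarrow> real) \<Rightarrow> (real \<Rightarrow> real) \<Rightarrow> bool" where
  "f1 N f f' \<longleftrightarrow> C1_halfline f f' \<and>
     (\<exists>A\<^sub>1 p q. A\<^sub>1 > 0 \<and> 2 < p \<and> p < crit_exp N \<and> crit_exp N < q \<and>
        (\<forall>(m, h)\<in>{(-1, primitive f), (0, f), (1, f')}. \<forall>s\<ge>0.
           (\<bar>s\<bar> \<ge> 1 \<longrightarrow> \<bar>h s\<bar> \<le> A\<^sub>1 * \<bar>s\<bar> powr (p - (m + 1))) \<and>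
           (\<bar>s\<bar> \<le> 1 \<longrightarrow> \<bar>h s\<bar> \<le> A\<^sub>1 * \<bar>s\<bar> powr (q - (m + 1)))))"

definition f2 :: "(real \<Rightarrow> real) \<Rightarrow> (real \<Rightarrow> real) \<Rightarrow> bool" where
  "f2 f f' \<longleftrightarrow> (\<exists>\<theta>>2. \<forall>s>0.
     0 \<le> \<theta> * primitive f s \<and> \<theta> * primitive f s \<le> f s * s \<and> f s * s < f' s * s\<^sup>2)"

text \<open>``Decreasing'' is read as non-increasing, and the limits are taken in the extended
  reals, since the one at \<open>0\<close> may be \<open>\<infinity>\<close>.\<close>

definition f3 :: "nat \<Rightarrow> (real \<Rightarrow> real) \<Rightarrow> (real \<Rightarrow> real) \<Rightarrow> bool" where
  "f3 N f f' \<longleftrightarrow> (let g = (\<lambda>s. s * f' s / f s) in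
     antimono_on {0<..} g \<and>
     (\<exists>a b :: ereal. ((\<lambda>s. ereal (g s)) \<longlongrightarrow> a) at_top \<and> ((\<lambda>s. ereal (g s)) \<longlongrightarrow> b) (at_right 0) \<and>
        a < ereal (crit_exp N - 1) \<and> ereal (crit_exp N - 1) < b))"

definition odd_extension :: "(real \<Rightarrow> real) \<Rightarrow> real \<Rightarrow> real" where
  "odd_extension f s = (if s < 0 then - f (- s) else f s)"

end

theory Submission
  imports Defs
begin

text \<open>
  By (f1), \<open>\<bar>f(s) s\<bar> \<le> A min(\<bar>s\<bar>\<^sup>p, \<bar>s\<bar>\<^sup>q)\<close>, so it is enough to control the measures
  \<open>\<lambda>\<^sub>k(t) = \<bar>{\<bar>u\<^sub>k\<bar> > t}\<bar>\<close>. If \<open>\<bar>u\<bar>\<close> exceeds \<open>t/2\<close> on at most half of every ball of radius \<open>r\<close>, then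
  at each point where \<open>\<bar>u(x)\<bar> > t\<close> at least half of the increments \<open>u(x + h) - u(x)\<close>, \<open>\<bar>h\<bar> < r\<close>, are
  larger than \<open>t/2\<close> in modulus; since the \<open>L\<^sup>2\<close> norm of an increment is at most \<open>\<bar>h\<bar>\<close> times that of the
  gradient, \<open>\<lambda>(t) \<le> 8 r\<^sup>2 \<parallel>\<nabla>u\<parallel>\<^sup>2 / t\<^sup>2\<close>. This is used twice. Put \<open>c = 2\<^sup>*\<close>. With \<open>r\<close> determined by the
  supremum \<open>W\<close> of \<open>t\<^sup>c \<lambda>(t)\<close>, finite by Chebyshev's inequality, it bounds \<open>W\<close> by a power of the gradient
  norm alone, hence \<open>t\<^sup>c \<lambda>\<^sub>k(t) \<le> K\<close> uniformly in \<open>k\<close>. With \<open>r\<close> fixed and small it shows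
  \<open>\<lambda>\<^sub>k(t) \<rightarrow> 0\<close> for every \<open>t > 0\<close>, because the vanishing hypothesis makes its premise true for large \<open>k\<close>.
  As \<open>p < c < q\<close>, a dyadic decomposition of the values of \<open>u\<^sub>k\<close> and dominated convergence conclude.
\<close>

section \<open>Test functions approximating boxes\<close>

text \<open>Uniqueness of the derivative replaces the chosen value \<open>frechet_derivative\<close>
  by any explicit derivative, so that the recursion of \<open>Ck\<close> can be run on
  formulas.\<close>

lemma Ck_SucI:
  assumes "\<And>x. (\<phi> has_derivative \<phi>' x) (at x)"
    and "\<And>i. i \<in> Basis \<Longrightarrow> Ck k (\<lambda>x. \<phi>' x i)"
  shows "Ck (Suc k) \<phi>"
proof -
  have "frechet_derivative \<phi> (at x) = \<phi>' x" for x
    using frechet_derivative_at[OF assms(1)] by simp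
  then show ?thesis
    using assms by (auto simp: differentiable_def)
qed

lemma Ck_SucD:
  assumes "Ck (Suc k) \<phi>"
  shows "(\<phi> has_derivative frechet_derivative \<phi> (at x)) (at x)"
    and "i \<in> Basis \<Longrightarrow> Ck k (\<lambda>x. frechet_derivative \<phi> (at x) i)"
  using assms by (auto simp: frechet_derivative_works[symmetric])

text \<open>This serves the product rule, where each term of the derivative keeps one factor
  undifferentiated.\<close>

lemma Ck_Suc_imp: "Ck (Suc k) \<phi> \<Longrightarrow> Ck k \<phi>"
proof (induction k arbitrary: \<phi>)
  case 0
  then have "\<And>x. \<phi> differentiable (at x)" by simp
  then have "continuous_on UNIV \<phi>"
    by (meson continuous_at_imp_continuous_on differentiable_imp_continuous_within)
  then show ?case by simp
next
  case (Suc k)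
  then show ?case by (metis Ck.simps(2))
qed

lemma Ck_const: "Ck k (\<lambda>x::'a::euclidean_space. c)"
proof (induction k arbitrary: c)
  case (Suc k)
  show ?case by (rule Ck_SucI[where \<phi>'="\<lambda>_ _. 0"]) (auto intro: Suc)
qed simp

lemma Ck_add: "Ck k \<phi> \<Longrightarrow> Ck k \<psi> \<Longrightarrow> Ck k (\<lambda>x. \<phi> x + \<psi> x)"
proof (induction k arbitrary: \<phi> \<psi>)
  case (Suc k)
  show ?case
    by (rule Ck_SucI[OF has_derivative_add[OF Ck_SucD(1)[OF Suc.prems(1)] Ck_SucD(1)[OF Suc.prems(2)]]])
      (intro Suc.IH Ck_SucD Suc.prems)
qed (auto intro: continuous_intros)

lemma Ck_mult: "Ck k \<phi> \<Longrightarrow> Ck k \<psi> \<Longrightarrow> Ck k (\<lambda>x. \<phi> x * \<psi> x)"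
proof (induction k arbitrary: \<phi> \<psi>)
  case (Suc k)
  show ?case
    by (rule Ck_SucI[OF has_derivative_mult[OF Ck_SucD(1)[OF Suc.prems(1)] Ck_SucD(1)[OF Suc.prems(2)]]])
      (intro Ck_add Suc.IH Ck_SucD Suc.prems Ck_Suc_imp)
qed (auto intro: continuous_intros)

lemma Ck_prod: "finite I \<Longrightarrow> (\<And>i. i \<in> I \<Longrightarrow> Ck k (\<phi> i)) \<Longrightarrow> Ck k (\<lambda>x. \<Prod>i\<in>I. \<phi> i x)"
  by (induction I rule: finite_induct) (auto intro: Ck_const Ck_mult)

text \<open>The directional derivative along \<open>i\<close> only multiplies the constant by the
  inner product of \<open>i\<close> and \<open>v\<close> and raises the index by one. The induction
  therefore closes once the constant \<open>c\<close> and the index \<open>m\<close> are both left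
  arbitrary.\<close>

lemma Ck_compose_affine:
  fixes D :: "nat \<Rightarrow> real \<Rightarrow> real" and v :: "'a::euclidean_space"
  assumes D: "\<And>m t. (D m has_real_derivative D (Suc m) t) (at t)"
  shows "Ck k (\<lambda>x. c * D m (x \<bullet> v + d))"
proof (induction k arbitrary: c m)
  case 0
  have "continuous_on UNIV (D m)"
    using D by (meson DERIV_isCont continuous_at_imp_continuous_on)
  then have "continuous_on UNIV (\<lambda>x. D m (x \<bullet> v + d))"
    by (rule continuous_on_compose2) (auto intro!: continuous_intros)
  then show ?case by (auto intro!: continuous_intros)
next
  case (Suc k)
  have "((\<lambda>x. c * D m (x \<bullet> v + d)) has_derivative
      (\<lambda>y. c * ((y \<bullet> v) * D (Suc m) (x \<bullet> v + d)))) (at x)" for x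
    by (auto intro!: derivative_eq_intros DERIV_compose_FDERIV[OF D])
  moreover have "Ck k (\<lambda>x. c * ((i \<bullet> v) * D (Suc m) (x \<bullet> v + d)))" for i
    using Suc[of "c * (i \<bullet> v)" "Suc m"] by (simp add: mult.assoc)
  ultimately show ?case by (intro Ck_SucI) auto
qed

lemma has_derivative_translate:
  fixes \<phi> :: "'a::real_normed_vector \<Rightarrow> 'b::real_normed_vector"
  assumes "(\<phi> has_derivative D) (at (x - v))"
  shows "((\<lambda>x. \<phi> (x - v)) has_derivative D) (at x)"
proof -
  have "((\<lambda>x. x - v) has_derivative (\<lambda>x. x)) (at x)"
    by (auto intro!: derivative_eq_intros)
  from has_derivative_compose[OF this assms] show ?thesis .
qed

lemma Ck_translate: "Ck k \<phi> \<Longrightarrow> Ck k (\<lambda>x. \<phi> (x - v))"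
proof (induction k arbitrary: \<phi>)
  case 0
  then show ?case by (auto intro!: continuous_intros elim!: continuous_on_compose2)
next
  case (Suc k)
  show ?case
    by (rule Ck_SucI[OF has_derivative_translate[OF Ck_SucD(1)[OF Suc.prems]]])
      (rule Suc.IH[OF Ck_SucD(2)[OF Suc.prems]])
qed

section \<open>A smooth function of one variable vanishing on the nonpositive half-line\<close>

definition flat :: "real poly \<Rightarrow> real \<Rightarrow> real" where
  "flat p t = (if t > 0 then poly p (1 / t) * exp (- (1 / t)) else 0)"

lemma poly_times_exp_tendsto_0: "((\<lambda>y. poly p y * exp (- y)) \<longlongrightarrow> (0::real)) at_top"
proof -
  have "((\<lambda>y. \<Sum>i\<le>degree p. coeff p i * (y ^ i / exp y)) \<longlongrightarrow> (\<Sum>i\<le>degree p. coeff p i * 0)) at_top"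
    by (intro tendsto_intros tendsto_power_div_exp_0)
  then show ?thesis
    by (simp add: poly_altdef sum_distrib_right exp_minus divide_inverse mult.assoc)
qed

lemma flat_tendsto_0: "(flat p \<longlongrightarrow> 0) (at 0)"
proof -
  have "((\<lambda>t. poly p (1 / t) * exp (- (1 / t))) \<longlongrightarrow> 0) (at_right 0)"
    using filterlim_compose[OF poly_times_exp_tendsto_0 filterlim_inverse_at_top_right]
    by (simp add: inverse_eq_divide)
  moreover have "eventually (\<lambda>t. poly p (1 / t) * exp (- (1 / t)) = flat p t) (at_right 0)"
    by (auto simp: flat_def eventually_at_filter)
  ultimately have "(flat p \<longlongrightarrow> 0) (at_right 0)"
    by (rule Lim_transform_eventually)
  moreover have "(flat p \<longlongrightarrow> 0) (at_left 0)"
    by (rule Lim_transform_eventually[OF tendsto_const]) (auto simp: flat_def eventually_at_filter)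
  ultimately show ?thesis by (simp add: filterlim_at_split)
qed

text \<open>With y = 1/t one has d/dt = - y^2 d/dy, and d/dy maps p(y) exp(-y) to (p' - p)(y)
  exp(-y); the factor \<open>[:0, 0, 1:]\<close> is y^2. So the family \<open>flat p\<close> is
  closed under differentiation, which is why the polynomial is a parameter.\<close>

lemma flat_has_derivative:
  "(flat p has_real_derivative flat ((p - pderiv p) * [:0, 0, 1:]) t) (at t)"
proof -
  consider "t > 0" | "t < 0" | "t = 0" by linarith
  then show ?thesis
  proof cases
    case 1
    have "((\<lambda>t. poly p (1 / t) * exp (- (1 / t))) has_real_derivative
        flat ((p - pderiv p) * [:0, 0, 1:]) t) (at t)"
      using 1
      by (auto intro!: derivative_eq_intros DERIV_chain'[OF _ poly_DERIV] simp: flat_def field_simps power2_eq_square)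
    then show ?thesis
      by (rule has_field_derivative_transform_within_open[of _ _ _ "{0<..}"]) (use 1 in \<open>auto simp: flat_def\<close>)
  next
    case 2
    have "((\<lambda>t. 0) has_real_derivative flat ((p - pderiv p) * [:0, 0, 1:]) t) (at t)"
      using 2 by (auto simp: flat_def)
    then show ?thesis
      by (rule has_field_derivative_transform_within_open[of _ _ _ "{..<0}"]) (use 2 in \<open>auto simp: flat_def\<close>)
  next
    case 3
    \<comment> \<open>Dividing by t multiplies the polynomial by y = 1/t, so the difference quotient
      at 0 is again a member of the family and tends to 0.\<close>
    have "((\<lambda>t. (flat p t - flat p 0) / (t - 0)) \<longlongrightarrow> 0) (at 0)"
      by (rule Lim_transform_eventually[OF flat_tendsto_0[of "p * [:0, 1:]"]])
        (auto simp: flat_def eventually_at_filter)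
    then show ?thesis
      using 3 by (simp add: has_field_derivative_iff flat_def)
  qed
qed

definition flat1 :: "real \<Rightarrow> real" where "flat1 = flat 1"

lemma Ck_flat1: "Ck k (\<lambda>x::'a::euclidean_space. flat1 (x \<bullet> v + d))"
proof -
  \<comment> \<open>The derivatives of \<open>flat1\<close> of all orders, obtained by iterating on
    the polynomial 1 the map found in \<open>flat_has_derivative\<close>.\<close>
  define D where "D m = flat (((\<lambda>p. (p - pderiv p) * [:0, 0, 1:]) ^^ m) 1)" for m
  have "Ck k (\<lambda>x::'a. 1 * D 0 (x \<bullet> v + d))"
    by (rule Ck_compose_affine) (simp add: D_def flat_has_derivative del: mult_pCons_right)
  then show ?thesis by (simp add: D_def flat1_def)
qed

lemma flat1_nonneg: "0 \<le> flat1 t" and flat1_le_1: "flat1 t \<le> 1"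
  by (auto simp: flat1_def flat_def)

lemma flat1_eq_0_iff: "flat1 t = 0 \<longleftrightarrow> t \<le> 0"
  by (auto simp: flat1_def flat_def)

lemma flat1_scaled_tendsto: "(\<lambda>n. flat1 (real n * t)) \<longlonglongrightarrow> (if t > 0 then 1 else 0)"
proof (cases "t > 0")
  case True
  have "(\<lambda>n. exp (- (inverse (real n) / t))) \<longlonglongrightarrow> exp (- (0 / t))"
    by (intro tendsto_intros LIMSEQ_inverse_real_of_nat lim_inverse_n) (use True in auto)
  moreover have "eventually (\<lambda>n. exp (- (inverse (real n) / t)) = flat1 (real n * t)) sequentially"
    using eventually_gt_at_top[of 0] by eventually_elim (use True in \<open>auto simp: flat1_def flat_def field_simps\<close>)
  ultimately show ?thesis
    using True by (simp add: Lim_transform_eventually)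
next
  case False
  then show ?thesis by (auto simp: flat1_def flat_def zero_less_mult_iff)
qed

text \<open>The scaling by \<open>n\<close> drives each factor exp(-1/(n t)) to 1 for t > 0, while
  it stays 0 for t \<le> 0. All bumps take values between 0 and 1 and vanish off the same open box,
  so the indicator of the box dominates them in the passage to the limit.\<close>

definition box_bump :: "nat \<Rightarrow> 'a::euclidean_space \<Rightarrow> 'a \<Rightarrow> 'a \<Rightarrow> real" where
  "box_bump n a b x = (\<Prod>i\<in>Basis. flat1 (real n * (x \<bullet> i - a \<bullet> i)) * flat1 (real n * (b \<bullet> i - x \<bullet> i)))"

lemma box_bump_nonneg: "0 \<le> box_bump n a b x" and box_bump_le_1: "box_bump n a b x \<le> 1"
  unfolding box_bump_def
  by (auto intro!: prod_nonneg prod_le_1 mult_le_one mult_nonneg_nonneg simp: flat1_nonneg flat1_le_1)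

lemma box_bump_tendsto: "(\<lambda>n. box_bump n a b x) \<longlonglongrightarrow> indicator (box a b) x"
proof -
  have "(\<lambda>n. box_bump n a b x) \<longlonglongrightarrow>
     (\<Prod>i\<in>Basis. (if x \<bullet> i - a \<bullet> i > 0 then 1 else 0) * (if b \<bullet> i - x \<bullet> i > 0 then 1 else 0))"
    unfolding box_bump_def by (intro tendsto_intros flat1_scaled_tendsto)
  also have "(\<Prod>i\<in>Basis. (if x \<bullet> i - a \<bullet> i > 0 then 1 else 0) * (if b \<bullet> i - x \<bullet> i > 0 then 1 else 0))
      = (indicator (box a b) x :: real)"
  proof (cases "x \<in> box a b")
    case True
    then show ?thesis by (auto simp: mem_box)
  next
    case False
    then obtain i :: 'a where "i \<in> Basis" "x \<bullet> i \<le> a \<bullet> i \<or> b \<bullet> i \<le> x \<bullet> i"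
      by (auto simp: mem_box not_less)
    then show ?thesis using False by (auto intro!: prod_zero bexI[of _ i])
  qed
  finally show ?thesis .
qed

lemma box_bump_support:
  assumes "box_bump n a b x \<noteq> 0"
  shows "x \<in> box a b"
proof -
  have "flat1 (real n * (x \<bullet> i - a \<bullet> i)) \<noteq> 0 \<and> flat1 (real n * (b \<bullet> i - x \<bullet> i)) \<noteq> 0" if "i \<in> Basis" for i
    using assms that by (auto simp: box_bump_def prod_zero_iff)
  then show ?thesis
    by (auto simp: mem_box flat1_eq_0_iff not_le zero_less_mult_iff)
qed

lemma test_function_box_bump: "test_function (box_bump n a (b::'a::euclidean_space))"
  unfolding test_function_def
proof
  have "Ck k (\<lambda>x::'a. flat1 (x \<bullet> (real n *\<^sub>R i) + - real n * (a \<bullet> i)) * flat1 (x \<bullet> (- real n *\<^sub>R i) + real n * (b \<bullet> i)))" for k i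
    by (intro Ck_mult Ck_flat1)
  then have "Ck k (\<lambda>x. \<Prod>i\<in>Basis. flat1 (x \<bullet> (real n *\<^sub>R i) + - real n * (a \<bullet> i)) * flat1 (x \<bullet> (- real n *\<^sub>R i) + real n * (b \<bullet> i)))" for k
    by (intro Ck_prod) auto
  then show "\<forall>k. Ck k (box_bump n a b)"
    by (simp add: box_bump_def[abs_def] algebra_simps)
  show "compact (closure {x. box_bump n a b x \<noteq> 0})"
    unfolding compact_closure
    by (rule bounded_subset[OF bounded_box]) (use box_bump_support in blast)
qed

section \<open>The fundamental lemma\<close>

text \<open>Testing with box bumps and passing to the limit shows that \<open>z\<close> has integral
  0 over every box. Hence the measures with densities z^+ and z^- agree on boxes, which form an
  intersection-stable generator of the Borel sets, and so they are equal.\<close>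

lemma fundamental_lemma_calculus_of_variations:
  fixes z :: "'a::euclidean_space \<Rightarrow> real"
  assumes z[measurable]: "z \<in> borel_measurable borel"
    and loc: "\<And>a b. set_integrable lborel (box a b) z"
    and test: "\<And>\<phi>. test_function \<phi> \<Longrightarrow> (LINT x|lborel. z x * \<phi> x) = 0"
  shows "AE x in lborel. z x = 0"
proof -
  have [measurable]: "box_bump n a (b::'a) \<in> borel_measurable borel" for n a b
    using test_function_box_bump[of n a b]
    by (metis Ck.simps(1) borel_measurable_continuous_onI test_function_def)
  have int0: "(LINT x:box a b|lborel. z x) = 0" for a b
  proof -
    have "(\<lambda>n. LINT x|lborel. z x * box_bump n a b x) \<longlonglongrightarrow> (LINT x|lborel. indicator (box a b) x *\<^sub>R z x)"
    proof (rule integral_dominated_convergence[where w="\<lambda>x. norm (indicator (box a b) x *\<^sub>R z x)"])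
      show "integrable lborel (\<lambda>x. norm (indicator (box a b) x *\<^sub>R z x))"
        using loc[of a b] by (intro integrable_norm) (simp add: set_integrable_def)
      show "AE x in lborel. (\<lambda>n. z x * box_bump n a b x) \<longlonglongrightarrow> indicator (box a b) x *\<^sub>R z x"
        by (auto intro!: AE_I2 tendsto_eq_intros box_bump_tendsto)
      show "AE x in lborel. norm (z x * box_bump n a b x) \<le> norm (indicator (box a b) x *\<^sub>R z x)" for n
      proof (rule AE_I2)
        fix x
        show "norm (z x * box_bump n a b x) \<le> norm (indicator (box a b) x *\<^sub>R z x)"
        proof (cases "box_bump n a b x = 0")
          case False
          then have "x \<in> box a b" by (rule box_bump_support)
          then show ?thesis
            using box_bump_nonneg[of n a b x] box_bump_le_1[of n a b x]
            by (auto simp: abs_mult intro!: mult_left_le)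
        qed auto
      qed
    qed auto
    moreover have "(LINT x|lborel. z x * box_bump n a b x) = 0" for n
      by (rule test[OF test_function_box_bump])
    ultimately show ?thesis
      by (simp add: set_lebesgue_integral_def LIMSEQ_const_iff)
  qed
  \<comment> \<open>Since \<open>ennreal\<close> sends negative reals to 0, the two densities are
    the positive and the negative part of \<open>z\<close>.\<close>
  let ?P = "density lborel (\<lambda>x. ennreal (z x))" and ?N = "density lborel (\<lambda>x. ennreal (- z x))"
  \<comment> \<open>Both parts have finite integral over a box, so the masses of boxes are real
    numbers and can be subtracted.\<close>
  have fin: "integrable lborel (\<lambda>x. max 0 (z x) * indicator (box a b) x)"
    "integrable lborel (\<lambda>x. max 0 (- z x) * indicator (box a b) x)" for a b
    using loc[of a b] unfolding set_integrable_def
    by (auto intro: Bochner_Integration.integrable_bound simp: indicator_def)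
  have P: "emeasure ?P (box a b) = ennreal (LINT x|lborel. max 0 (z x) * indicator (box a b) x)" for a b
    by (subst emeasure_density, simp, simp, subst nn_integral_eq_integral[symmetric, OF fin(1)])
      (auto intro!: nn_integral_cong simp: indicator_def max_def ennreal_neg)
  have N: "emeasure ?N (box a b) = ennreal (LINT x|lborel. max 0 (- z x) * indicator (box a b) x)" for a b
    by (subst emeasure_density, simp, simp, subst nn_integral_eq_integral[symmetric, OF fin(2)])
      (auto intro!: nn_integral_cong simp: indicator_def max_def ennreal_neg)
  have "(LINT x|lborel. max 0 (z x) * indicator (box a b) x) - (LINT x|lborel. max 0 (- z x) * indicator (box a b) x) = 0" for a b
  proof -
    have "(LINT x|lborel. max 0 (z x) * indicator (box a b) x) - (LINT x|lborel. max 0 (- z x) * indicator (box a b) x)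
        = (LINT x|lborel. max 0 (z x) * indicator (box a b) x - max 0 (- z x) * indicator (box a b) x)"
      by (rule Bochner_Integration.integral_diff[OF fin, symmetric])
    also have "\<dots> = (LINT x:box a b|lborel. z x)"
      unfolding set_lebesgue_integral_def
      by (auto intro!: Bochner_Integration.integral_cong simp: indicator_def max_def)
    finally show ?thesis by (simp add: int0)
  qed
  then have eq: "emeasure ?P (box a b) = emeasure ?N (box a b)" for a b
    by (simp add: P N)
  have "?P = ?N"
  proof (rule measure_eqI_generator_eq[where E="range (\<lambda>(a, b). box a (b::'a))" and \<Omega>=UNIV
        and A="\<lambda>n. box (- (real n *\<^sub>R One)) (real n *\<^sub>R One)"])
    show "Int_stable (range (\<lambda>(a, b). box a (b::'a)))"
      by (auto simp: Int_stable_def box_Int_box)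
    show "sets ?P = sigma_sets UNIV (range (\<lambda>(a, b). box a (b::'a)))"
      "sets ?N = sigma_sets UNIV (range (\<lambda>(a, b). box a (b::'a)))"
      by (simp_all add: borel_eq_box)
    show "(\<Union>n. box (- (real n *\<^sub>R One)) (real n *\<^sub>R One)) = (UNIV :: 'a set)"
      by (rule UN_box_eq_UNIV)
  qed (auto simp: eq P N)
  \<comment> \<open>Densities are unique almost everywhere. At most one of
    \<open>ennreal (z x)\<close> and \<open>ennreal (- z x)\<close> is nonzero, so their equality
    forces \<open>z x = 0\<close>.\<close>
  then have "AE x in lborel. ennreal (z x) = ennreal (- z x)"
    by (subst (asm) sigma_finite_measure.density_unique_iff[OF sigma_finite_lborel]) auto
  then show ?thesis
    by eventually_elim (metis add.inverse_inverse ennreal_eq_0_iff ennreal_neg le_cases neg_0_le_iff_le order_antisym)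
qed

section \<open>Translations, and averages over the unit interval\<close>

lemma nn_integral_lborel_translate:
  fixes v :: "'a::euclidean_space"
  assumes [measurable]: "f \<in> borel_measurable borel"
  shows "(\<integral>\<^sup>+x. f (x + v) \<partial>lborel) = (\<integral>\<^sup>+x. f x \<partial>lborel)"
  by (subst (2) lborel_distr_plus[of v, symmetric], subst nn_integral_distr) (auto simp: add.commute)

lemma integral_lborel_translate:
  fixes v :: "'a::euclidean_space" and f :: "'a \<Rightarrow> real"
  assumes [measurable]: "f \<in> borel_measurable borel"
  shows "(LINT x|lborel. f (x + v)) = (LINT x|lborel. f x)"
  by (subst (2) lborel_distr_plus[of v, symmetric], subst integral_distr) (auto simp: add.commute)

lemma integrable_lborel_translate:
  fixes v :: "'a::euclidean_space" and f :: "'a \<Rightarrow> real"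
  assumes [measurable]: "f \<in> borel_measurable borel" and "integrable lborel f"
  shows "integrable lborel (\<lambda>x. f (x + v))"
  using assms(2) by (subst (asm) lborel_distr_plus[of v, symmetric], subst (asm) integrable_distr_eq) (auto simp: add.commute)

text \<open>The unit interval is encoded as a measure of total mass 1 on the whole line. Averages
  along segments then need no indicator functions, and the Fubini theorems for the product with
  \<open>lborel\<close> apply directly.\<close>

definition unit_lborel :: "real measure" where
  "unit_lborel = density lborel (indicator {0..1})"

lemma sets_unit_lborel [simp, measurable_cong]: "sets unit_lborel = sets borel"
  by (simp add: unit_lborel_def)

lemma space_unit_lborel [simp]: "space unit_lborel = UNIV"
  by (simp add: unit_lborel_def)

lemma emeasure_unit_lborel: "emeasure unit_lborel UNIV = 1"
  by (simp add: unit_lborel_def emeasure_density)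

interpretation unit_lborel: finite_measure unit_lborel
  by (rule finite_measureI) (simp add: emeasure_unit_lborel)

interpretation lborel_unit: pair_sigma_finite lborel unit_lborel ..

lemma AE_unit_lborel: "AE s in unit_lborel. s \<in> {0..1}"
  unfolding unit_lborel_def by (subst AE_density) (auto simp: indicator_def)

lemma integral_unit_lborel:
  fixes g :: "real \<Rightarrow> real"
  assumes [measurable]: "g \<in> borel_measurable borel"
  shows "(LINT s|unit_lborel. g s) = (LINT s|lborel. g s * indicator {0..1} s)"
proof -
  have unit: "unit_lborel = density lborel (\<lambda>s. ennreal (indicator {0..1} s))"
    by (simp add: unit_lborel_def ennreal_indicator)
  show ?thesis
    unfolding unit by (subst integral_density) (auto simp: mult.commute)
qed

text \<open>Cauchy-Schwarz against the constant 1, whose integral is 1. If \<open>g\<close> is not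
  integrable, its Bochner integral is 0 by convention and the bound is trivial.\<close>

lemma integral_power2_le_nn_integral:
  fixes g :: "real \<Rightarrow> real"
  assumes [measurable]: "g \<in> borel_measurable borel"
  shows "ennreal ((LINT s|unit_lborel. g s)\<^sup>2) \<le> (\<integral>\<^sup>+s. ennreal ((g s)\<^sup>2) \<partial>unit_lborel)"
proof (cases "integrable unit_lborel g")
  case True
  have "ennreal ((LINT s|unit_lborel. g s)\<^sup>2) = (ennreal (norm (LINT s|unit_lborel. g s)))\<^sup>2"
    by (simp add: ennreal_power)
  also have "\<dots> \<le> (\<integral>\<^sup>+s. ennreal (norm (g s)) * 1 \<partial>unit_lborel)\<^sup>2"
    using integral_norm_bound_ennreal[OF True] by (simp add: power_mono)
  also have "\<dots> \<le> (\<integral>\<^sup>+s. (ennreal (norm (g s)))\<^sup>2 \<partial>unit_lborel) * (\<integral>\<^sup>+s. 1\<^sup>2 \<partial>unit_lborel)"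
    by (rule Cauchy_Schwarz_nn_integral) auto
  also have "\<dots> = (\<integral>\<^sup>+s. ennreal ((g s)\<^sup>2) \<partial>unit_lborel)"
    by (simp add: emeasure_unit_lborel ennreal_power)
  finally show ?thesis .
qed (simp add: not_integrable_integral_eq)

section \<open>Difference quotients of weakly differentiable functions\<close>

lemma integrable_mult_bounded_support:
  fixes g \<psi> :: "'a::euclidean_space \<Rightarrow> real"
  assumes [measurable]: "g \<in> borel_measurable borel" "\<psi> \<in> borel_measurable borel"
    and loc: "set_integrable lborel (cball 0 \<rho>) g"
    and supp: "\<And>x. \<psi> x \<noteq> 0 \<Longrightarrow> norm x \<le> \<rho>" and bnd: "\<And>x. \<bar>\<psi> x\<bar> \<le> B"
  shows "integrable lborel (\<lambda>x. g x * \<psi> x)"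
proof (rule Bochner_Integration.integrable_bound)
  show "integrable lborel (\<lambda>x. B * (indicator (cball 0 \<rho>) x *\<^sub>R g x))"
    using loc unfolding set_integrable_def by (intro integrable_mult_right)
  have "B \<ge> 0" using bnd[of 0] by linarith
  have "norm (g x * \<psi> x) \<le> norm (B * (indicator (cball 0 \<rho>) x *\<^sub>R g x))" for x
  proof (cases "\<psi> x = 0")
    case False
    then have "norm (B * (indicator (cball 0 \<rho>) x *\<^sub>R g x)) = B * \<bar>g x\<bar>"
      using supp[OF False] \<open>B \<ge> 0\<close> by (simp add: abs_mult)
    moreover have "norm (g x * \<psi> x) \<le> B * \<bar>g x\<bar>"
      using mult_right_mono[OF bnd[of x], of "\<bar>g x\<bar>"] by (simp add: abs_mult mult.commute)
    ultimately show ?thesis by simp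
  qed simp
  then show "AE x in lborel. norm (g x * \<psi> x) \<le> norm (B * (indicator (cball 0 \<rho>) x *\<^sub>R g x))"
    by simp
qed simp

text \<open>If 0 \<le> s \<le> 1 and \<open>x - s *\<^sub>R h\<close> lies in the ball of radius
  \<open>\<rho>\<close>, then x lies in the ball of radius \<open>\<rho> + norm h\<close>. The inner
  integrals are thus bounded by a finite \<open>K\<close> independent of s. The second claim reduces
  to the first by translating x by \<open>s *\<^sub>R h\<close>.\<close>

lemma
  fixes g \<psi> :: "'a::euclidean_space \<Rightarrow> real"
  assumes [measurable]: "g \<in> borel_measurable borel" "\<psi> \<in> borel_measurable borel"
    and loc: "\<And>\<rho>. set_integrable lborel (cball 0 \<rho>) g"
    and supp: "\<And>x. \<psi> x \<noteq> 0 \<Longrightarrow> norm x \<le> \<rho>" and bnd: "\<And>x. \<bar>\<psi> x\<bar> \<le> B"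
  shows integrable_segment_shift: "integrable (lborel \<Otimes>\<^sub>M unit_lborel) (\<lambda>(x, s). g x * \<psi> (x - s *\<^sub>R h))"
    and integrable_segment_shift': "integrable (lborel \<Otimes>\<^sub>M unit_lborel) (\<lambda>(x, s). g (x + s *\<^sub>R h) * \<psi> x)"
proof -
  have "B \<ge> 0" using bnd[of 0] by linarith
  define K where "K = (\<integral>\<^sup>+x. ennreal (norm (B * (indicator (cball 0 (\<rho> + norm h)) x *\<^sub>R g x))) \<partial>lborel)"
  have "integrable lborel (\<lambda>x. B * (indicator (cball 0 (\<rho> + norm h)) x *\<^sub>R g x))"
    using loc unfolding set_integrable_def by (intro integrable_mult_right)
  then have "K < \<infinity>" unfolding K_def by (subst (asm) integrable_iff_bounded) blast
  have inner: "(\<integral>\<^sup>+x. ennreal (norm (g x * \<psi> (x - s *\<^sub>R h))) \<partial>lborel) \<le> K" if s: "s \<in> {0..1}" for s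
    unfolding K_def
  proof (intro nn_integral_mono ennreal_leI)
    fix x
    show "norm (g x * \<psi> (x - s *\<^sub>R h)) \<le> norm (B * (indicator (cball 0 (\<rho> + norm h)) x *\<^sub>R g x))"
    proof (cases "\<psi> (x - s *\<^sub>R h) = 0")
      case False
      have "norm x \<le> norm (x - s *\<^sub>R h) + norm (s *\<^sub>R h)" by (metis add.commute norm_triangle_sub)
      also have "\<dots> \<le> \<rho> + norm h" using supp[OF False] s by (intro add_mono) (auto simp: mult_left_le_one_le)
      finally have "norm (B * (indicator (cball 0 (\<rho> + norm h)) x *\<^sub>R g x)) = B * \<bar>g x\<bar>"
        using \<open>B \<ge> 0\<close> by (simp add: abs_mult)
      moreover have "norm (g x * \<psi> (x - s *\<^sub>R h)) \<le> B * \<bar>g x\<bar>"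
        using mult_right_mono[OF bnd[of "x - s *\<^sub>R h"], of "\<bar>g x\<bar>"] by (simp add: abs_mult mult.commute)
      ultimately show ?thesis by simp
    qed simp
  qed
  \<comment> \<open>The bound \<open>inner\<close> is available for s in the unit interval, that is,
    almost everywhere for \<open>unit_lborel\<close>.\<close>
  have "(\<integral>\<^sup>+s. (\<integral>\<^sup>+x. ennreal (norm (g x * \<psi> (x - s *\<^sub>R h))) \<partial>lborel) \<partial>unit_lborel) \<le> (\<integral>\<^sup>+s. K \<partial>unit_lborel)"
    using AE_unit_lborel by (intro nn_integral_mono_AE) (rule eventually_mono, assumption, rule inner)
  also have "\<dots> = K"
    by (simp add: emeasure_unit_lborel)
  finally have fin: "(\<integral>\<^sup>+s. (\<integral>\<^sup>+x. ennreal (norm (g x * \<psi> (x - s *\<^sub>R h))) \<partial>lborel) \<partial>unit_lborel) < \<infinity>"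
    using \<open>K < \<infinity>\<close> by order
  show "integrable (lborel \<Otimes>\<^sub>M unit_lborel) (\<lambda>(x, s). g x * \<psi> (x - s *\<^sub>R h))"
  proof (rule integrableI_bounded)
    show "(\<integral>\<^sup>+ x. ennreal (norm (case x of (x, s) \<Rightarrow> g x * \<psi> (x - s *\<^sub>R h))) \<partial>(lborel \<Otimes>\<^sub>M unit_lborel)) < \<infinity>"
      using fin by (subst lborel_unit.nn_integral_snd[symmetric]) auto
  qed simp
  have "(\<integral>\<^sup>+x. ennreal (norm (g (x + s *\<^sub>R h) * \<psi> x)) \<partial>lborel)
      = (\<integral>\<^sup>+x. ennreal (norm (g x * \<psi> (x - s *\<^sub>R h))) \<partial>lborel)" for s
    using nn_integral_lborel_translate[of "\<lambda>x. ennreal (norm (g x * \<psi> (x - s *\<^sub>R h)))" "s *\<^sub>R h"] by simp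
  then have fin': "(\<integral>\<^sup>+s. (\<integral>\<^sup>+x. ennreal (norm (g (x + s *\<^sub>R h) * \<psi> x)) \<partial>lborel) \<partial>unit_lborel) < \<infinity>"
    using fin by simp
  show "integrable (lborel \<Otimes>\<^sub>M unit_lborel) (\<lambda>(x, s). g (x + s *\<^sub>R h) * \<psi> x)"
  proof (rule integrableI_bounded)
    show "(\<integral>\<^sup>+ x. ennreal (norm (case x of (x, s) \<Rightarrow> g (x + s *\<^sub>R h) * \<psi> x)) \<partial>(lborel \<Otimes>\<^sub>M unit_lborel)) < \<infinity>"
      using fin' by (subst lborel_unit.nn_integral_snd[symmetric]) auto
  qed simp
qed

lemma bounded_support_imp_bounded:
  fixes \<psi> :: "'a::euclidean_space \<Rightarrow> real"
  assumes "continuous_on UNIV \<psi>" and supp: "\<And>x. \<psi> x \<noteq> 0 \<Longrightarrow> norm x \<le> \<rho>"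
  obtains B where "\<And>x. \<bar>\<psi> x\<bar> \<le> B"
proof -
  have "bounded (\<psi> ` cball 0 \<rho>)"
    by (intro compact_imp_bounded compact_continuous_image continuous_on_subset[OF assms(1)]) auto
  then obtain B where B: "\<And>x. x \<in> cball 0 \<rho> \<Longrightarrow> \<bar>\<psi> x\<bar> \<le> B"
    unfolding bounded_iff by fastforce
  have "\<bar>\<psi> x\<bar> \<le> max B 0" for x
    using B[of x] supp[of x] by (cases "\<psi> x = 0") auto
  then show ?thesis by (rule that)
qed

section \<open>Test functions: supports, translates and differences\<close>

context
  fixes \<phi> :: "'a::euclidean_space \<Rightarrow> real"
  assumes \<phi>: "test_function \<phi>"
begin

lemma test_function_has_derivative: "(\<phi> has_derivative frechet_derivative \<phi> (at x)) (at x)"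
  using \<phi> Ck_SucD(1) unfolding test_function_def by blast

lemma test_function_continuous: "continuous_on UNIV \<phi>"
  using \<phi> unfolding test_function_def by (metis Ck.simps(1))

lemma test_function_derivative_sum:
  "frechet_derivative \<phi> (at x) h = (\<Sum>i\<in>Basis. (h \<bullet> i) * frechet_derivative \<phi> (at x) i)"
proof -
  have "linear (frechet_derivative \<phi> (at x))"
    using test_function_has_derivative by (rule has_derivative_linear)
  then have "frechet_derivative \<phi> (at x) (\<Sum>i\<in>Basis. (h \<bullet> i) *\<^sub>R i) = (\<Sum>i\<in>Basis. (h \<bullet> i) *\<^sub>R frechet_derivative \<phi> (at x) i)"
    by (simp add: linear_sum linear_cmul)
  then show ?thesis by (simp add: euclidean_representation)
qed

lemma test_function_derivative_continuous: "continuous_on UNIV (\<lambda>x. frechet_derivative \<phi> (at x) h)"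
proof -
  have "continuous_on UNIV (\<lambda>x. frechet_derivative \<phi> (at x) i)" if "i \<in> Basis" for i
    using Ck_SucD(2)[of 0 \<phi> i] \<phi> that unfolding test_function_def by simp
  then show ?thesis
    by (subst test_function_derivative_sum) (auto intro!: continuous_intros)
qed

lemma test_function_support:
  obtains \<rho> where "\<And>x. \<phi> x \<noteq> 0 \<Longrightarrow> norm x \<le> \<rho>"
    and "\<And>x h. frechet_derivative \<phi> (at x) h \<noteq> 0 \<Longrightarrow> norm x \<le> \<rho>"
proof -
  have "bounded {x. \<phi> x \<noteq> 0}"
    using \<phi> unfolding test_function_def by (meson bounded_subset closure_subset compact_imp_bounded)
  then obtain \<rho> where \<rho>: "\<And>x. \<phi> x \<noteq> 0 \<Longrightarrow> norm x \<le> \<rho>"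
    by (auto simp: bounded_iff)
  \<comment> \<open>The complement of the closed ball is open and the function is identically 0
    there, so the same radius serves for the derivative.\<close>
  have "frechet_derivative \<phi> (at x) h = 0" if "norm x > \<rho>" for x h
  proof -
    have "open {x::'a. norm x > \<rho>}"
      by (intro open_Collect_less continuous_intros)
    then have "(\<phi> has_derivative (\<lambda>_. 0)) (at x)"
      by (rule has_derivative_transform_within_open[OF has_derivative_const[of 0]])
        (use that \<rho> in \<open>force+\<close>)
    then show ?thesis using frechet_derivative_at by metis
  qed
  then show ?thesis by (metis \<rho> that not_le)
qed

lemma test_function_translate: "test_function (\<lambda>x. \<phi> (x - v))"
proof -
  have eq: "{x. \<phi> (x - v) \<noteq> 0} = (\<lambda>x. v + x) ` {x. \<phi> x \<noteq> 0}"
    by (auto simp: image_iff) (metis add.commute diff_add_cancel)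
  have "bounded {x. \<phi> (x - v) \<noteq> 0}"
    unfolding eq using \<phi> unfolding test_function_def
    by (meson bounded_subset bounded_translation closure_subset compact_imp_bounded)
  then show ?thesis
    using \<phi> by (auto simp: test_function_def intro: Ck_translate)
qed

lemma frechet_derivative_translate:
  "frechet_derivative (\<lambda>x. \<phi> (x - v)) (at x) = frechet_derivative \<phi> (at (x - v))"
  using frechet_derivative_at[OF has_derivative_translate[OF test_function_has_derivative]] by simp

text \<open>The fundamental theorem of calculus along the segment from x to x - h; the sign comes
  from differentiating \<open>x - s *\<^sub>R h\<close> in s.\<close>

lemma test_function_difference:
  "\<phi> (x - h) - \<phi> x = - (LINT s|unit_lborel. frechet_derivative \<phi> (at (x - s *\<^sub>R h)) h)"
proof -
  have cont: "continuous_on UNIV (\<lambda>s. frechet_derivative \<phi> (at (x - s *\<^sub>R h)) h)"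
    by (rule continuous_on_compose2[OF test_function_derivative_continuous]) (auto intro!: continuous_intros)
  have deriv: "((\<lambda>s. \<phi> (x - s *\<^sub>R h)) has_real_derivative - frechet_derivative \<phi> (at (x - s *\<^sub>R h)) h) (at s)" for s
  proof -
    have "((\<lambda>s. x - s *\<^sub>R h) has_derivative (\<lambda>t. - (t *\<^sub>R h))) (at s)"
      by (auto intro!: derivative_eq_intros)
    from has_derivative_compose[OF this test_function_has_derivative]
    have "((\<lambda>s. \<phi> (x - s *\<^sub>R h)) has_derivative (\<lambda>t. frechet_derivative \<phi> (at (x - s *\<^sub>R h)) (- (t *\<^sub>R h)))) (at s)" .
    moreover have "linear (frechet_derivative \<phi> (at (x - s *\<^sub>R h)))"
      using test_function_has_derivative by (rule has_derivative_linear)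
    moreover have "(*) (- c) = (\<lambda>t. - (t * c))" for c :: real
      by (auto simp: fun_eq_iff)
    ultimately show ?thesis
      by (simp add: has_field_derivative_def linear_neg linear_cmul)
  qed
  have cont': "continuous_on UNIV (\<lambda>s. - frechet_derivative \<phi> (at (x - s *\<^sub>R h)) h)"
    using cont by (rule continuous_on_minus)
  have "(LINT s|unit_lborel. - frechet_derivative \<phi> (at (x - s *\<^sub>R h)) h)
      = (LINT s|lborel. - frechet_derivative \<phi> (at (x - s *\<^sub>R h)) h * indicator {0..1} s)"
    using cont' by (intro integral_unit_lborel borel_measurable_continuous_onI)
  also have "\<dots> = \<phi> (x - 1 *\<^sub>R h) - \<phi> (x - 0 *\<^sub>R h)"
    using deriv cont' by (intro integral_FTC_Icc_real) (auto simp: continuous_on_eq_continuous_at)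
  finally have "(LINT s|unit_lborel. - frechet_derivative \<phi> (at (x - s *\<^sub>R h)) h) = \<phi> (x - 1 *\<^sub>R h) - \<phi> (x - 0 *\<^sub>R h)" .
  then show ?thesis by simp
qed

end

text \<open>The space is defined with the completed measure, whereas Fubini and translations are
  applied to \<open>lborel\<close>. For Borel functions integrability is the same for both.\<close>

lemma locally_integrable_lborel:
  fixes g :: "'a::euclidean_space \<Rightarrow> 'b::euclidean_space"
  assumes "locally_integrable g" and [measurable]: "g \<in> borel_measurable borel"
  shows "set_integrable lborel (cball 0 \<rho>) g"
proof -
  have "integrable lebesgue (\<lambda>x. indicator (cball 0 \<rho>) x *\<^sub>R g x)"
    using assms(1) unfolding locally_integrable_def set_integrable_def by simp
  moreover have "(\<lambda>x. indicator (cball 0 \<rho>) x *\<^sub>R g x) \<in> borel_measurable lborel"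
    using assms(2) by (intro borel_measurable_scaleR borel_measurable_indicator) auto
  ultimately show ?thesis
    unfolding set_integrable_def by (simp add: integrable_completion)
qed

section \<open>Weak gradients and the mean square of increments\<close>

context
  fixes u :: "'a::euclidean_space \<Rightarrow> real" and G :: "'a \<Rightarrow> 'a"
  assumes wg: "weak_gradient u G"
    and u_borel [measurable]: "u \<in> borel_measurable borel"
    and G_borel [measurable]: "G \<in> borel_measurable borel"
begin

lemma weak_gradient_locally_integrable:
  shows "set_integrable lborel (cball 0 \<rho>) u"
    and "set_integrable lborel (cball 0 \<rho>) (\<lambda>x. G x \<bullet> h)"
proof -
  show "set_integrable lborel (cball 0 \<rho>) u"
    using wg u_borel by (intro locally_integrable_lborel) (auto simp: weak_gradient_def)
  have "set_integrable lborel (cball 0 \<rho>) G"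
    using wg G_borel by (intro locally_integrable_lborel) (auto simp: weak_gradient_def)
  then show "set_integrable lborel (cball 0 \<rho>) (\<lambda>x. G x \<bullet> h)"
    unfolding set_integrable_def using integrable_inner_left[of h lborel "\<lambda>x. indicator (cball 0 \<rho>) x *\<^sub>R G x"] by simp
qed

text \<open>The definition tests coordinate directions only; the general direction follows by
  expanding \<open>h\<close> in the basis. Boundedness and bounded support of the test function make
  each term integrable, which allows the finite sum to leave the integral.\<close>

lemma weak_gradient_direction:
  assumes \<phi>: "test_function \<phi>"
  shows "(LINT x|lborel. u x * frechet_derivative \<phi> (at x) h) = - (LINT x|lborel. (G x \<bullet> h) * \<phi> x)"
proof -
  obtain \<rho> where \<rho>: "\<And>x. \<phi> x \<noteq> 0 \<Longrightarrow> norm x \<le> \<rho>"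
    "\<And>x h. frechet_derivative \<phi> (at x) h \<noteq> 0 \<Longrightarrow> norm x \<le> \<rho>"
    using test_function_support[OF \<phi>] by blast
  have [measurable]: "\<phi> \<in> borel_measurable borel" "(\<lambda>x. frechet_derivative \<phi> (at x) i) \<in> borel_measurable borel" for i
    using test_function_continuous[OF \<phi>] test_function_derivative_continuous[OF \<phi>]
    by (auto intro: borel_measurable_continuous_onI)
  have int1: "integrable lborel (\<lambda>x. u x * frechet_derivative \<phi> (at x) i)" for i
  proof -
    obtain B where "\<And>x. \<bar>frechet_derivative \<phi> (at x) i\<bar> \<le> B"
      using bounded_support_imp_bounded[OF test_function_derivative_continuous[OF \<phi>] \<rho>(2)[where h=i]] by blast
    then show ?thesis
      by (intro integrable_mult_bounded_support[OF _ _ weak_gradient_locally_integrable(1)[of \<rho>]]) (use \<rho>(2)[where h=i] in auto)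
  qed
  have int2: "integrable lborel (\<lambda>x. (G x \<bullet> i) * \<phi> x)" for i
  proof -
    obtain B where "\<And>x. \<bar>\<phi> x\<bar> \<le> B"
      using bounded_support_imp_bounded[OF test_function_continuous[OF \<phi>] \<rho>(1)] by blast
    then show ?thesis
      by (intro integrable_mult_bounded_support[OF _ _ weak_gradient_locally_integrable(2)[of \<rho>]]) (use \<rho>(1) in auto)
  qed
  have basis: "(LINT x|lborel. u x * frechet_derivative \<phi> (at x) i) = - (LINT x|lborel. (G x \<bullet> i) * \<phi> x)"
    if "i \<in> Basis" for i
  proof -
    have "(LINT x|lebesgue. u x * frechet_derivative \<phi> (at x) i) = - (LINT x|lebesgue. (G x \<bullet> i) * \<phi> x)"
      using wg \<phi> that unfolding weak_gradient_def by blast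
    then show ?thesis by (subst (asm) (1 2) integral_completion) auto
  qed
  have "(LINT x|lborel. u x * frechet_derivative \<phi> (at x) h)
      = (LINT x|lborel. (\<Sum>i\<in>Basis. (h \<bullet> i) * (u x * frechet_derivative \<phi> (at x) i)))"
    by (subst test_function_derivative_sum[OF \<phi>]) (simp add: sum_distrib_left mult_ac)
  also have "\<dots> = (\<Sum>i\<in>Basis. (h \<bullet> i) * (LINT x|lborel. u x * frechet_derivative \<phi> (at x) i))"
    using int1 by (subst Bochner_Integration.integral_sum) auto
  also have "\<dots> = (\<Sum>i\<in>Basis. (h \<bullet> i) * - (LINT x|lborel. (G x \<bullet> i) * \<phi> x))"
    using basis by (intro sum.cong) auto
  also have "\<dots> = - (LINT x|lborel. (\<Sum>i\<in>Basis. (h \<bullet> i) * ((G x \<bullet> i) * \<phi> x)))"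
    using int2 by (subst Bochner_Integration.integral_sum) (auto simp: sum_negf)
  also have "\<dots> = - (LINT x|lborel. (G x \<bullet> h) * \<phi> x)"
    by (simp add: euclidean_inner[of "G _" h] sum_distrib_left sum_distrib_right mult_ac)
  finally show ?thesis .
qed

text \<open>The weak form of u(x + h) - u(x) being the average of \<open>G\<close> times
  \<open>h\<close> along the segment. A translation moves the increment onto the test function,
  whose increment is an average of derivatives; for each s one integrates by parts and translates
  back. Fubini is used before and after.\<close>

lemma weak_gradient_difference:
  assumes \<phi>: "test_function \<phi>"
  shows "(LINT x|lborel. (u (x + h) - u x) * \<phi> x)
    = (LINT x|lborel. (LINT s|unit_lborel. G (x + s *\<^sub>R h) \<bullet> h) * \<phi> x)"
proof -
  let ?P = "\<lambda>x. frechet_derivative \<phi> (at x) h"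
  obtain \<rho> where \<rho>: "\<And>x. \<phi> x \<noteq> 0 \<Longrightarrow> norm x \<le> \<rho>" "\<And>x. ?P x \<noteq> 0 \<Longrightarrow> norm x \<le> \<rho>"
    using test_function_support[OF \<phi>] by metis
  have [measurable]: "\<phi> \<in> borel_measurable borel" "?P \<in> borel_measurable borel"
    using test_function_continuous[OF \<phi>] test_function_derivative_continuous[OF \<phi>]
    by (auto intro: borel_measurable_continuous_onI)
  obtain B where B: "\<And>x. \<bar>?P x\<bar> \<le> B"
    using bounded_support_imp_bounded[OF test_function_derivative_continuous[OF \<phi>] \<rho>(2)] by blast
  obtain B' where B': "\<And>x. \<bar>\<phi> x\<bar> \<le> B'"
    using bounded_support_imp_bounded[OF test_function_continuous[OF \<phi>] \<rho>(1)] by blast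
  have int1: "integrable lborel (\<lambda>x. u x * \<phi> (x - h))"
  proof (rule integrable_mult_bounded_support[OF _ _ weak_gradient_locally_integrable(1)[of "\<rho> + norm h"]])
    show "norm x \<le> \<rho> + norm h" if "\<phi> (x - h) \<noteq> 0" for x
      using \<rho>(1)[OF that] norm_triangle_sub[of x h] by linarith
  qed (use B' in auto)
  have int2: "integrable lborel (\<lambda>x. u x * \<phi> x)"
    by (rule integrable_mult_bounded_support[OF _ _ weak_gradient_locally_integrable(1)[of \<rho>]]) (use \<rho>(1) B' in auto)
  have int1': "integrable lborel (\<lambda>x. u (x + h) * \<phi> x)"
    using integrable_lborel_translate[OF _ int1, of h] by simp
  have "(LINT x|lborel. (u (x + h) - u x) * \<phi> x) = (LINT x|lborel. u (x + h) * \<phi> x) - (LINT x|lborel. u x * \<phi> x)"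
    using int1' int2 by (simp add: left_diff_distrib)
  also have "(LINT x|lborel. u (x + h) * \<phi> x) = (LINT x|lborel. u x * \<phi> (x - h))"
    using integral_lborel_translate[of "\<lambda>x. u x * \<phi> (x - h)" h] by simp
  also have "\<dots> - (LINT x|lborel. u x * \<phi> x) = (LINT x|lborel. u x * (\<phi> (x - h) - \<phi> x))"
    using int1 int2 by (simp add: right_diff_distrib)
  also have "\<dots> = - (LINT x|lborel. (LINT s|unit_lborel. u x * ?P (x - s *\<^sub>R h)))"
    by (simp add: test_function_difference[OF \<phi>])
  also have "(LINT x|lborel. (LINT s|unit_lborel. u x * ?P (x - s *\<^sub>R h)))
      = (LINT s|unit_lborel. (LINT x|lborel. u x * ?P (x - s *\<^sub>R h)))"
    by (intro lborel_unit.Fubini_integral[symmetric]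
        integrable_segment_shift[OF _ _ weak_gradient_locally_integrable(1), where \<rho>=\<rho> and B=B])
      (use \<rho>(2) B in auto)
  also have "\<dots> = (LINT s|unit_lborel. - (LINT x|lborel. (G (x + s *\<^sub>R h) \<bullet> h) * \<phi> x))"
  proof (intro Bochner_Integration.integral_cong refl)
    fix s :: real
    \<comment> \<open>The integration by parts is applied to the test function translated by
      \<open>s *\<^sub>R h\<close>.\<close>
    have "(LINT x|lborel. u x * ?P (x - s *\<^sub>R h)) = - (LINT x|lborel. (G x \<bullet> h) * \<phi> (x - s *\<^sub>R h))"
      using weak_gradient_direction[OF test_function_translate[OF \<phi>, of "s *\<^sub>R h"], of h]
      by (simp add: frechet_derivative_translate[OF \<phi>])
    also have "(LINT x|lborel. (G x \<bullet> h) * \<phi> (x - s *\<^sub>R h)) = (LINT x|lborel. (G (x + s *\<^sub>R h) \<bullet> h) * \<phi> x)"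
      using integral_lborel_translate[of "\<lambda>x. (G x \<bullet> h) * \<phi> (x - s *\<^sub>R h)" "s *\<^sub>R h"] by simp
    finally show "(LINT x|lborel. u x * ?P (x - s *\<^sub>R h)) = - (LINT x|lborel. (G (x + s *\<^sub>R h) \<bullet> h) * \<phi> x)" .
  qed
  also have "- \<dots> = (LINT s|unit_lborel. (LINT x|lborel. (G (x + s *\<^sub>R h) \<bullet> h) * \<phi> x))"
    by simp
  also have "\<dots> = (LINT x|lborel. (LINT s|unit_lborel. (G (x + s *\<^sub>R h) \<bullet> h) * \<phi> x))"
    by (intro lborel_unit.Fubini_integral
        integrable_segment_shift'[OF _ _ weak_gradient_locally_integrable(2), where \<rho>=\<rho> and B=B'])
      (use \<rho>(1) B' in auto)
  finally show ?thesis by simp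
qed

text \<open>The fundamental lemma turns the weak identity into equality almost everywhere of the
  increment and the segment average \<open>w\<close>. Cauchy-Schwarz in s, Tonelli and translation
  invariance then bound the square of \<open>w\<close>.\<close>

lemma weak_gradient_difference_quotient:
  "(\<integral>\<^sup>+x. ennreal ((u (x + h) - u x)\<^sup>2) \<partial>lborel)
    \<le> ennreal ((norm h)\<^sup>2) * (\<integral>\<^sup>+x. ennreal ((norm (G x))\<^sup>2) \<partial>lborel)"
proof -
  have [measurable]: "cball (0::'a) \<rho> \<in> sets borel" for \<rho>
    by simp
  define w where "w x = (LINT s|unit_lborel. G (x + s *\<^sub>R h) \<bullet> h)" for x
  have w[measurable]: "w \<in> borel_measurable borel"
    unfolding w_def[abs_def] by (intro unit_lborel.borel_measurable_lebesgue_integral) simp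
  have loc_w: "set_integrable lborel (cball 0 \<rho>) w" for \<rho>
  proof -
    \<comment> \<open>The indicator of a ball takes the place of the test function, with bound 1;
      Fubini then yields the local integrability of \<open>w\<close>.\<close>
    have "integrable (lborel \<Otimes>\<^sub>M unit_lborel) (\<lambda>(x, s). (G (x + s *\<^sub>R h) \<bullet> h) * indicator (cball 0 \<rho>) x)"
      by (rule integrable_segment_shift'[OF _ _ weak_gradient_locally_integrable(2), where \<rho>=\<rho> and B=1])
        (auto simp: indicator_def)
    from lborel_unit.integrable_fst'[OF this] show ?thesis
      unfolding set_integrable_def w_def by (simp add: mult.commute)
  qed
  have loc_shift: "set_integrable lborel (cball 0 \<rho>) (\<lambda>x. u (x + h))" for \<rho>
  proof -
    have "integrable lborel (\<lambda>x. u x * indicator (cball 0 \<rho>) (x - h))"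
    proof (rule integrable_mult_bounded_support[OF _ _ weak_gradient_locally_integrable(1)[of "\<rho> + norm h"], where B=1])
      show "norm x \<le> \<rho> + norm h" if "indicator (cball 0 \<rho>) (x - h) \<noteq> (0::real)" for x
        using that norm_triangle_sub[of x h] by (auto simp: indicator_def split: if_splits)
    qed (auto simp: indicator_def)
    from integrable_lborel_translate[OF _ this, of h] show ?thesis
      by (simp add: set_integrable_def mult.commute)
  qed
  define z where "z x = u (x + h) - u x - w x" for x
  have [measurable]: "z \<in> borel_measurable borel" unfolding z_def[abs_def] by simp
  have loc_z: "set_integrable lborel (cball 0 \<rho>) z" for \<rho>
    unfolding z_def[abs_def] by (intro set_integral_diff loc_shift loc_w weak_gradient_locally_integrable)
  have "AE x in lborel. z x = 0"
  proof (rule fundamental_lemma_calculus_of_variations)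
    show "set_integrable lborel (box a b) z" for a b
    proof -
      obtain \<rho> where "box a b \<subseteq> cball 0 \<rho>"
        using bounded_subset_ballD[OF bounded_box] ball_subset_cball by (metis subset_trans)
      then show ?thesis by (intro set_integrable_subset[OF loc_z]) auto
    qed
  next
    fix \<phi> :: "'a \<Rightarrow> real" assume \<phi>: "test_function \<phi>"
    have [measurable]: "\<phi> \<in> borel_measurable borel"
      using test_function_continuous[OF \<phi>] by (rule borel_measurable_continuous_onI)
    obtain \<rho> where \<rho>: "\<And>x. \<phi> x \<noteq> 0 \<Longrightarrow> norm x \<le> \<rho>"
      using test_function_support[OF \<phi>] by metis
    obtain B where B: "\<And>x. \<bar>\<phi> x\<bar> \<le> B"
      using bounded_support_imp_bounded[OF test_function_continuous[OF \<phi>] \<rho>] by blast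
    have "integrable lborel (\<lambda>x. (u (x + h) - u x) * \<phi> x)" "integrable lborel (\<lambda>x. w x * \<phi> x)"
      by (rule integrable_mult_bounded_support[OF _ _ _ \<rho> B];
          auto intro!: set_integral_diff loc_shift loc_w weak_gradient_locally_integrable)+
    then have "(LINT x|lborel. z x * \<phi> x) = (LINT x|lborel. (u (x + h) - u x) * \<phi> x) - (LINT x|lborel. w x * \<phi> x)"
      by (simp add: z_def left_diff_distrib)
    then show "(LINT x|lborel. z x * \<phi> x) = 0"
      by (simp add: weak_gradient_difference[OF \<phi>] w_def)
  qed simp
  then have "(\<integral>\<^sup>+x. ennreal ((u (x + h) - u x)\<^sup>2) \<partial>lborel) = (\<integral>\<^sup>+x. ennreal ((w x)\<^sup>2) \<partial>lborel)"
    by (intro nn_integral_cong_AE) (auto elim!: eventually_mono simp: z_def)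
  also have "\<dots> \<le> (\<integral>\<^sup>+x. (\<integral>\<^sup>+s. ennreal ((G (x + s *\<^sub>R h) \<bullet> h)\<^sup>2) \<partial>unit_lborel) \<partial>lborel)"
    unfolding w_def by (intro nn_integral_mono integral_power2_le_nn_integral) simp
  also have "\<dots> = (\<integral>\<^sup>+s. (\<integral>\<^sup>+x. ennreal ((G (x + s *\<^sub>R h) \<bullet> h)\<^sup>2) \<partial>lborel) \<partial>unit_lborel)"
    by (intro lborel_unit.Fubini'[symmetric]) simp
  also have "\<dots> = (\<integral>\<^sup>+s. (\<integral>\<^sup>+x. ennreal ((G x \<bullet> h)\<^sup>2) \<partial>lborel) \<partial>unit_lborel)"
    by (intro nn_integral_cong nn_integral_lborel_translate) simp
  also have "\<dots> = (\<integral>\<^sup>+x. ennreal ((G x \<bullet> h)\<^sup>2) \<partial>lborel)"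
    by (simp add: emeasure_unit_lborel)
  also have "\<dots> \<le> (\<integral>\<^sup>+x. ennreal ((norm h)\<^sup>2) * ennreal ((norm (G x))\<^sup>2) \<partial>lborel)"
  proof (intro nn_integral_mono)
    fix x
    have "(G x \<bullet> h)\<^sup>2 \<le> (norm (G x) * norm h)\<^sup>2"
      using Cauchy_Schwarz_ineq2[of "G x" h] by (intro power2_le_iff_abs_le[THEN iffD2]) auto
    then show "ennreal ((G x \<bullet> h)\<^sup>2) \<le> ennreal ((norm h)\<^sup>2) * ennreal ((norm (G x))\<^sup>2)"
      by (simp add: ennreal_mult[symmetric] power_mult_distrib mult.commute)
  qed
  also have "\<dots> = ennreal ((norm h)\<^sup>2) * (\<integral>\<^sup>+x. ennreal ((norm (G x))\<^sup>2) \<partial>lborel)"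
    by (intro nn_integral_cmult) simp
  finally show ?thesis .
qed

end

section \<open>Estimates for level sets\<close>

lemma ennreal_le_divideI:
  assumes "ennreal c * a \<le> ennreal d" "c > 0" "d \<ge> 0"
  shows "a \<le> ennreal (d / c)"
proof -
  have "a = ennreal (1 / c) * (ennreal c * a)"
    using assms(2) by (simp add: mult.assoc[symmetric] ennreal_mult[symmetric])
  also have "\<dots> \<le> ennreal (1 / c) * ennreal d"
    using assms(1) by (intro mult_left_mono) auto
  also have "\<dots> = ennreal (d / c)"
    using assms(2,3) by (simp add: ennreal_mult[symmetric])
  finally show ?thesis .
qed

lemma emeasure_half_complement:
  fixes u :: "'a::euclidean_space \<Rightarrow> real"
  assumes [measurable]: "u \<in> borel_measurable borel"
    and half: "emeasure lborel {y \<in> ball x r. \<bar>u y\<bar> > a} \<le> ennreal (measure lborel (ball (0::'a) r) / 2)"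
  shows "ennreal (measure lborel (ball (0::'a) r) / 2) \<le> emeasure lborel {h \<in> ball 0 r. \<bar>u (x + h)\<bar> \<le> a}"
proof -
  let ?S = "{h \<in> ball 0 r. \<bar>u (x + h)\<bar> \<le> a}" and ?T = "{h \<in> ball 0 r. \<bar>u (x + h)\<bar> > a}"
  have [measurable]: "ball y r \<in> sets borel" for y :: 'a by simp
  have [measurable]: "?S \<in> sets borel" "?T \<in> sets borel" "{y \<in> ball x r. \<bar>u y\<bar> > a} \<in> sets borel"
    by measurable
  have fin: "emeasure lborel ?S < \<infinity>" "emeasure lborel ?T < \<infinity>"
    by (rule le_less_trans[OF emeasure_mono emeasure_bounded_finite[OF bounded_ball[of 0 r]]]; auto)+
  have "emeasure lborel ?T = (\<integral>\<^sup>+h. indicator ?T h \<partial>lborel)"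
    by (rule nn_integral_indicator[symmetric]) simp
  also have "\<dots> = (\<integral>\<^sup>+h. indicator {y \<in> ball x r. \<bar>u y\<bar> > a} (h + x) \<partial>lborel)"
    by (intro nn_integral_cong) (auto simp: indicator_def dist_norm add.commute)
  also have "\<dots> = emeasure lborel {y \<in> ball x r. \<bar>u y\<bar> > a}"
    by (subst nn_integral_lborel_translate) auto
  finally have "emeasure lborel ?T \<le> ennreal (measure lborel (ball (0::'a) r) / 2)"
    using half by simp
  moreover have "emeasure lborel ?T = ennreal (measure lborel ?T)"
    using fin(2) by (intro emeasure_eq_ennreal_measure) auto
  ultimately have "measure lborel ?T \<le> measure lborel (ball (0::'a) r) / 2"
    by simp
  moreover have "measure lborel (ball (0::'a) r) = measure lborel (?S \<union> ?T)"
    by (rule arg_cong[where f="measure lborel"]) auto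
  moreover have "measure lborel (?S \<union> ?T) = measure lborel ?S + measure lborel ?T"
    using fin by (intro measure_Union) auto
  ultimately have "measure lborel (ball (0::'a) r) / 2 \<le> measure lborel ?S"
    by linarith
  then show ?thesis
    using fin(1) by (simp add: emeasure_eq_ennreal_measure ennreal_leI)
qed

text \<open>Integrate \<open>(u(x + h) - u(x))\<^sup>2\<close> over \<open>h\<close> in the ball and all \<open>x\<close>, in both orders.\<close>

lemma level_set_estimate:
  fixes u :: "'a::euclidean_space \<Rightarrow> real"
  assumes [measurable]: "u \<in> borel_measurable borel"
    and diff: "\<And>h. (\<integral>\<^sup>+x. ennreal ((u (x + h) - u x)\<^sup>2) \<partial>lborel) \<le> ennreal ((norm h)\<^sup>2 * \<gamma>)"
    and "\<gamma> \<ge> 0" "r > 0" "t > 0"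
    and half: "\<And>x. emeasure lborel {y \<in> ball x r. \<bar>u y\<bar> > t / 2} \<le> ennreal (measure lborel (ball (0::'a) r) / 2)"
  shows "emeasure lborel {x. \<bar>u x\<bar> > t} \<le> ennreal (8 * r\<^sup>2 * \<gamma> / t\<^sup>2)"
proof -
  define \<beta> where "\<beta> = measure lborel (ball (0::'a) r)"
  have \<beta>: "\<beta> > 0" using \<open>r > 0\<close> by (simp add: \<beta>_def)
  have em: "emeasure lborel (ball (0::'a) r) = ennreal \<beta>"
    unfolding \<beta>_def by (intro emeasure_eq_ennreal_measure) (use emeasure_bounded_finite[of "ball (0::'a) r"] in auto)
  have [measurable]: "ball (0::'a) r \<in> sets borel" by simp
  \<comment> \<open>The constant is (t/2)^2 times half of the volume \<open>\<beta>\<close>: where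
    |u(x)| > t, at least half of the h in the ball satisfy |u(x + h)| \<le> t/2, and for these the
    increment has modulus at least t/2.\<close>
  have low: "ennreal (t\<^sup>2 * \<beta> / 8) * indicator {x. \<bar>u x\<bar> > t} x
      \<le> (\<integral>\<^sup>+h. ennreal ((u (x + h) - u x)\<^sup>2) * indicator (ball 0 r) h \<partial>lborel)" for x
  proof (cases "\<bar>u x\<bar> > t")
    case True
    let ?S = "{h \<in> ball 0 r. \<bar>u (x + h)\<bar> \<le> t / 2}"
    have "ennreal (t\<^sup>2 * \<beta> / 8) = ennreal (t\<^sup>2 / 4) * ennreal (\<beta> / 2)"
      using \<beta> by (simp add: ennreal_mult[symmetric])
    also have "\<dots> \<le> ennreal (t\<^sup>2 / 4) * emeasure lborel ?S"
      unfolding \<beta>_def by (intro mult_left_mono emeasure_half_complement half) auto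
    also have "\<dots> = (\<integral>\<^sup>+h. ennreal (t\<^sup>2 / 4) * indicator ?S h \<partial>lborel)"
      by (subst nn_integral_cmult_indicator) auto
    also have "\<dots> \<le> (\<integral>\<^sup>+h. ennreal ((u (x + h) - u x)\<^sup>2) * indicator (ball 0 r) h \<partial>lborel)"
    proof (intro nn_integral_mono)
      fix h
      have "t\<^sup>2 / 4 \<le> (u (x + h) - u x)\<^sup>2" if "\<bar>u (x + h)\<bar> \<le> t / 2"
      proof -
        have "\<bar>t / 2\<bar> \<le> \<bar>u (x + h) - u x\<bar>" using True that \<open>t > 0\<close> by linarith
        then have "(t / 2)\<^sup>2 \<le> (u (x + h) - u x)\<^sup>2" by (rule abs_le_square_iff[THEN iffD1])
        then show ?thesis by (simp add: power_divide)
      qed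
      then show "ennreal (t\<^sup>2 / 4) * indicator ?S h \<le> ennreal ((u (x + h) - u x)\<^sup>2) * indicator (ball 0 r) h"
        by (auto simp: indicator_def intro: ennreal_leI)
    qed
    finally show ?thesis using True by simp
  qed simp
  have "ennreal (t\<^sup>2 * \<beta> / 8) * emeasure lborel {x. \<bar>u x\<bar> > t}
      = (\<integral>\<^sup>+x. ennreal (t\<^sup>2 * \<beta> / 8) * indicator {x. \<bar>u x\<bar> > t} x \<partial>lborel)"
    by (subst nn_integral_cmult_indicator) auto
  also have "\<dots> \<le> (\<integral>\<^sup>+x. (\<integral>\<^sup>+h. ennreal ((u (x + h) - u x)\<^sup>2) * indicator (ball 0 r) h \<partial>lborel) \<partial>lborel)"
    by (intro nn_integral_mono low)
  also have "\<dots> = (\<integral>\<^sup>+h. (\<integral>\<^sup>+x. ennreal ((u (x + h) - u x)\<^sup>2) * indicator (ball 0 r) h \<partial>lborel) \<partial>lborel)"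
    by (intro lborel_pair.Fubini'[symmetric]) simp
  also have "\<dots> \<le> (\<integral>\<^sup>+h. ennreal (r\<^sup>2 * \<gamma>) * indicator (ball (0::'a) r) h \<partial>lborel)"
  proof (intro nn_integral_mono)
    fix h :: 'a
    have "(\<integral>\<^sup>+x. ennreal ((u (x + h) - u x)\<^sup>2) \<partial>lborel) \<le> ennreal (r\<^sup>2 * \<gamma>)" if "norm h < r"
      using that \<open>\<gamma> \<ge> 0\<close> by (intro order_trans[OF diff] ennreal_leI mult_right_mono power_mono) auto
    then show "(\<integral>\<^sup>+x. ennreal ((u (x + h) - u x)\<^sup>2) * indicator (ball 0 r) h \<partial>lborel)
        \<le> ennreal (r\<^sup>2 * \<gamma>) * indicator (ball 0 r) h"
      by (auto simp: indicator_def)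
  qed
  also have "\<dots> = ennreal (r\<^sup>2 * \<gamma> * \<beta>)"
    using \<open>\<gamma> \<ge> 0\<close> \<beta> by (subst nn_integral_cmult_indicator) (auto simp: em ennreal_mult)
  finally have "emeasure lborel {x. \<bar>u x\<bar> > t} \<le> ennreal (r\<^sup>2 * \<gamma> * \<beta> / (t\<^sup>2 * \<beta> / 8))"
    using \<open>\<gamma> \<ge> 0\<close> \<open>t > 0\<close> \<beta> by (intro ennreal_le_divideI) auto
  also have "r\<^sup>2 * \<gamma> * \<beta> / (t\<^sup>2 * \<beta> / 8) = 8 * r\<^sup>2 * \<gamma> / t\<^sup>2"
    using \<beta> \<open>t > 0\<close> by (simp add: field_simps)
  finally show ?thesis .
qed

text \<open>With \<open>W\<close> the supremum of \<open>t\<^sup>p \<lambda>(t)\<close>, choosing the radius so that half the volume of the ball is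
  \<open>W / (t/2)\<^sup>p\<close> gives \<open>W \<le> C W\<^sup>a\<close> with \<open>a = 2/N < 1\<close>; as \<open>W\<close> is finite, one can divide.\<close>

lemma weak_sobolev_inequality:
  fixes u :: "'a::euclidean_space \<Rightarrow> real"
  defines "N \<equiv> real DIM('a)" and "p \<equiv> crit_exp DIM('a)"
  assumes dim: "DIM('a) \<ge> 3"
    and [measurable]: "u \<in> borel_measurable borel"
    and Lp: "integrable lborel (\<lambda>x. \<bar>u x\<bar> powr p)"
    and diff: "\<And>h. (\<integral>\<^sup>+x. ennreal ((u (x + h) - u x)\<^sup>2) \<partial>lborel) \<le> ennreal ((norm h)\<^sup>2 * \<gamma>)"
    and "\<gamma> \<ge> 0" "t > 0"
  shows "emeasure lborel {x. \<bar>u x\<bar> > t}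
    \<le> ennreal ((8 * \<gamma> * (2 powr (1 + p) / unit_ball_vol N) powr (2 / N)) powr (N / (N - 2)) * t powr - p)"
proof -
  define \<omega> where "\<omega> = unit_ball_vol N"
  define C where "C = 8 * \<gamma> * (2 powr (1 + p) / \<omega>) powr (2 / N)"
  define M where "M = (LINT x|lborel. \<bar>u x\<bar> powr p)"
  \<comment> \<open>The supremum is over real numbers; Chebyshev's inequality bounds it by
    \<open>M\<close>, and this finiteness is what permits the division by a power of
    \<open>W\<close> below.\<close>
  define W where "W = (SUP s\<in>{0<..}. s powr p * measure lborel {x. \<bar>u x\<bar> > s})"
  have N: "N \<ge> 3" using dim by (simp add: N_def)
  have p: "p = 2 * N / (N - 2)" by (simp add: p_def crit_exp_def N_def)
  have p0: "p > 0" using N by (simp add: p)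
  have \<omega>: "\<omega> > 0" unfolding \<omega>_def N_def by simp
  have C0: "C \<ge> 0" using \<open>\<gamma> \<ge> 0\<close> by (simp add: C_def)
  have cheb: "emeasure lborel {x. \<bar>u x\<bar> > s} \<le> ennreal (M / s powr p)" if "s > 0" for s
  proof (rule ennreal_le_divideI)
    have "ennreal (s powr p) * emeasure lborel {x. \<bar>u x\<bar> > s}
        = (\<integral>\<^sup>+x. ennreal (s powr p) * indicator {x. \<bar>u x\<bar> > s} x \<partial>lborel)"
      by (subst nn_integral_cmult_indicator) auto
    also have "\<dots> \<le> (\<integral>\<^sup>+x. ennreal (\<bar>u x\<bar> powr p) \<partial>lborel)"
      using \<open>s > 0\<close> p0 by (intro nn_integral_mono) (auto simp: indicator_def intro!: ennreal_leI powr_mono2)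
    also have "\<dots> = ennreal M"
      unfolding M_def by (intro nn_integral_eq_integral Lp) auto
    finally show "ennreal (s powr p) * emeasure lborel {x. \<bar>u x\<bar> > s} \<le> ennreal M" .
  qed (use \<open>s > 0\<close> in \<open>auto simp: M_def\<close>)
  have em: "emeasure lborel {x. \<bar>u x\<bar> > s} = ennreal (measure lborel {x. \<bar>u x\<bar> > s})" if "s > 0" for s
    using cheb[OF that] by (intro emeasure_eq_ennreal_measure) (auto simp: top_unique)
  have M0: "M \<ge> 0" by (simp add: M_def)
  have bdd: "s powr p * measure lborel {x. \<bar>u x\<bar> > s} \<le> M" if "s > 0" for s
    using cheb[OF that] that M0 unfolding em[OF that] by (simp add: field_simps)
  have bdd_above: "bdd_above ((\<lambda>s. s powr p * measure lborel {x. \<bar>u x\<bar> > s}) ` {0<..})"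
    using bdd by (intro bdd_aboveI2[where M=M]) auto
  have upper: "s powr p * measure lborel {x. \<bar>u x\<bar> > s} \<le> W" if "s > 0" for s
    unfolding W_def using that by (intro cSUP_upper bdd_above) auto
  have W0: "W \<ge> 0"
    using upper[of 1] by (simp add: order_trans[OF measure_nonneg])
  have "W \<le> C powr (N / (N - 2))"
  proof (cases "W = 0")
    case False
    with W0 have "W > 0" by simp
    have "s powr p * measure lborel {x. \<bar>u x\<bar> > s} \<le> C * W powr (2 / N)" if "s > 0" for s
    proof -
      \<comment> \<open>The radius for which half the volume of the ball is W (s/2)^(-p). By the
        definition of \<open>W\<close> this bounds the measure of the whole set where |u| > s/2, so
        the half-ball condition holds around every point.\<close>
      define r where "r = (2 * W * (s / 2) powr - p / \<omega>) powr (1 / N)"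
      have r: "r > 0" using \<open>W > 0\<close> \<omega> that by (simp add: r_def)
      have rN: "r ^ DIM('a) = 2 * W * (s / 2) powr - p / \<omega>"
        using \<open>W > 0\<close> \<omega> that N r
        by (subst powr_realpow[symmetric, OF r]) (simp add: r_def powr_powr N_def[symmetric])
      have vol: "measure lborel (ball (0::'a) r) / 2 = W * (s / 2) powr - p"
        using r \<omega> by (subst content_ball) (auto simp: rN \<omega>_def[symmetric] N_def[symmetric])
      have "emeasure lborel {x. \<bar>u x\<bar> > s} \<le> ennreal (8 * r\<^sup>2 * \<gamma> / s\<^sup>2)"
      proof (rule level_set_estimate[OF _ diff])
        fix x
        have "emeasure lborel {y \<in> ball x r. \<bar>u y\<bar> > s / 2} \<le> emeasure lborel {y. \<bar>u y\<bar> > s / 2}"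
          by (intro emeasure_mono) auto
        also have "\<dots> = ennreal (measure lborel {y. \<bar>u y\<bar> > s / 2})"
          using that by (intro em) auto
        also have "\<dots> \<le> ennreal (W * (s / 2) powr - p)"
          using upper[of "s / 2"] that by (intro ennreal_leI) (simp add: powr_minus field_simps)
        finally show "emeasure lborel {y \<in> ball x r. \<bar>u y\<bar> > s / 2} \<le> ennreal (measure lborel (ball (0::'a) r) / 2)"
          by (simp only: vol)
      qed (use r \<open>\<gamma> \<ge> 0\<close> that in auto)
      then have le: "measure lborel {x. \<bar>u x\<bar> > s} \<le> 8 * r\<^sup>2 * \<gamma> / s\<^sup>2"
        unfolding em[OF that] using \<open>\<gamma> \<ge> 0\<close> by simp
      have "r\<^sup>2 = (2 * W * (s / 2) powr - p / \<omega>) powr (2 / N)"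
        using r by (subst powr_realpow[symmetric]) (auto simp: r_def powr_powr)
      also have "2 * W * (s / 2) powr - p / \<omega> = (2 powr (1 + p) / \<omega>) * W * s powr - p"
        using that by (simp add: powr_divide powr_minus powr_add field_simps)
      also have "\<dots> powr (2 / N) = (2 powr (1 + p) / \<omega>) powr (2 / N) * W powr (2 / N) * s powr (- p * (2 / N))"
      proof -
        have key: "(a * W * s powr - p) powr (2 / N) = a powr (2 / N) * W powr (2 / N) * s powr (- p * (2 / N))"
          if "a > 0" for a
          using that \<open>W > 0\<close> by (simp add: powr_mult powr_powr)
        show ?thesis by (rule key) (use \<omega> in simp)
      qed
      finally have r2: "r\<^sup>2 = (2 powr (1 + p) / \<omega>) powr (2 / N) * W powr (2 / N) * s powr (- p * (2 / N))" .
      have "s powr p * measure lborel {x. \<bar>u x\<bar> > s} \<le> s powr p * (8 * r\<^sup>2 * \<gamma> / s\<^sup>2)"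
        by (intro mult_left_mono le) auto
      also have "s\<^sup>2 = s powr 2" using that by (simp add: powr_numeral)
      also have "s powr p * (8 * r\<^sup>2 * \<gamma> / s powr 2) = C * W powr (2 / N) * (s powr p * s powr (- p * (2 / N)) * s powr - 2)"
        unfolding r2 C_def by (simp add: powr_minus_divide)
      also have "s powr p * s powr (- p * (2 / N)) * s powr - 2 = s powr (p + - p * (2 / N) + - 2)"
        by (simp only: powr_add)
      \<comment> \<open>The critical exponent enters here: p = 2N/(N - 2) is the value for which all
        powers of s cancel.\<close>
      also have "p + - p * (2 / N) + - 2 = 0"
        using N by (simp add: p divide_simps)
      finally show ?thesis using that by simp
    qed
    then have "W \<le> C * W powr (2 / N)"
      unfolding W_def by (intro cSUP_least) auto
    \<comment> \<open>Dividing by W^(2/N), with W positive, leaves the exponent (N - 2)/N, which is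
      positive and is then inverted.\<close>
    then have "W * W powr (- (2 / N)) \<le> C * W powr (2 / N) * W powr (- (2 / N))"
      by (intro mult_right_mono) auto
    also have "\<dots> = C"
      using \<open>W > 0\<close> by (simp add: powr_minus)
    also have "W * W powr (- (2 / N)) = W powr (1 + - (2 / N))"
      using \<open>W > 0\<close> by (subst powr_add) simp
    also have "1 + - (2 / N) = (N - 2) / N"
      using N by (simp add: field_simps)
    finally have "(W powr ((N - 2) / N)) powr (N / (N - 2)) \<le> C powr (N / (N - 2))"
      using N by (intro powr_mono2) auto
    then show ?thesis
      using N \<open>W > 0\<close> by (simp add: powr_powr)
  qed simp
  then have "t powr p * measure lborel {x. \<bar>u x\<bar> > t} \<le> C powr (N / (N - 2))"
    using upper[OF \<open>t > 0\<close>] by linarith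
  then have "measure lborel {x. \<bar>u x\<bar> > t} \<le> C powr (N / (N - 2)) * t powr - p"
    using \<open>t > 0\<close> by (simp add: powr_minus field_simps)
  then show ?thesis
    unfolding em[OF \<open>t > 0\<close>] C_def \<omega>_def by (rule ennreal_leI)
qed

text \<open>A small fixed radius makes the bound of \<open>level_set_estimate\<close> as small as
  desired. For that radius the half-ball condition holds for all large k, by Chebyshev's inequality
  on balls and the vanishing hypothesis.\<close>

lemma level_sets_vanish:
  fixes u :: "nat \<Rightarrow> 'a::euclidean_space \<Rightarrow> real"
  assumes [measurable]: "\<And>k. u k \<in> borel_measurable borel"
    and diff: "\<And>k h. (\<integral>\<^sup>+x. ennreal ((u k (x + h) - u k x)\<^sup>2) \<partial>lborel) \<le> ennreal ((norm h)\<^sup>2 * \<gamma>)"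
    and "\<gamma> \<ge> 0" "R > 0" "t > 0"
    and van: "(\<lambda>k. SUP y. \<integral>\<^sup>+x\<in>ball y R. ennreal (\<bar>u k x\<bar>\<^sup>2) \<partial>lborel) \<longlonglongrightarrow> 0"
  shows "(\<lambda>k. emeasure lborel {x. \<bar>u k x\<bar> > t}) \<longlonglongrightarrow> 0"
proof (rule order_tendstoI)
  fix e :: ennreal assume "0 < e"
  \<comment> \<open>The tolerance \<open>e\<close> may be infinite, so a positive real below it is
    used instead.\<close>
  then obtain \<epsilon> :: real where \<epsilon>: "\<epsilon> > 0" "ennreal \<epsilon> < e"
  proof (cases e rule: ennreal_cases)
    case (real x)
    then show thesis using \<open>0 < e\<close> that[of "x / 2"] by (auto simp: ennreal_less_iff)
  qed (use that[of 1] in auto)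
  \<comment> \<open>The minimum with \<open>R\<close> places the small ball inside the ball of the
    hypothesis; \<open>\<gamma> + 1\<close> avoids a division by 0 when \<open>\<gamma>\<close> is
    0.\<close>
  define r where "r = min R (sqrt (\<epsilon> * t\<^sup>2 / (8 * (\<gamma> + 1))))"
  have r: "r > 0" using \<epsilon> \<open>R > 0\<close> \<open>t > 0\<close> \<open>\<gamma> \<ge> 0\<close> by (simp add: r_def)
  have "r\<^sup>2 \<le> (sqrt (\<epsilon> * t\<^sup>2 / (8 * (\<gamma> + 1))))\<^sup>2"
    using r by (intro power_mono) (auto simp: r_def)
  also have "\<dots> = \<epsilon> * t\<^sup>2 / (8 * (\<gamma> + 1))"
    using \<epsilon> \<open>\<gamma> \<ge> 0\<close> by simp
  finally have "8 * r\<^sup>2 * (\<gamma> + 1) \<le> \<epsilon> * t\<^sup>2"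
    using \<open>\<gamma> \<ge> 0\<close> by (simp add: field_simps)
  then have small: "8 * r\<^sup>2 * \<gamma> / t\<^sup>2 \<le> \<epsilon>"
    using \<open>t > 0\<close> by (simp add: field_simps)
      (smt (verit) zero_le_power2)
  \<comment> \<open>A set of half the volume of the ball of radius \<open>r\<close> on which |u| >
    t/2 contributes at least \<open>\<delta>\<close> to the integral of u^2.\<close>
  define \<delta> where "\<delta> = t\<^sup>2 / 4 * (measure lborel (ball (0::'a) r) / 2)"
  have "\<delta> > 0" using r \<open>t > 0\<close> by (simp add: \<delta>_def)
  then have "eventually (\<lambda>k. (SUP y. \<integral>\<^sup>+x\<in>ball y R. ennreal (\<bar>u k x\<bar>\<^sup>2) \<partial>lborel) < ennreal \<delta>) sequentially"
    by (intro order_tendstoD(2)[OF van]) simp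
  then show "eventually (\<lambda>k. emeasure lborel {x. \<bar>u k x\<bar> > t} < e) sequentially"
  proof eventually_elim
    case (elim k)
    have "emeasure lborel {x. \<bar>u k x\<bar> > t} \<le> ennreal (8 * r\<^sup>2 * \<gamma> / t\<^sup>2)"
    proof (rule level_set_estimate[OF _ diff])
      fix x
      have "ennreal (t\<^sup>2 / 4) * emeasure lborel {y \<in> ball x r. \<bar>u k y\<bar> > t / 2}
          = (\<integral>\<^sup>+y. ennreal (t\<^sup>2 / 4) * indicator {y \<in> ball x r. \<bar>u k y\<bar> > t / 2} y \<partial>lborel)"
      proof -
        have [measurable]: "ball x r \<in> sets borel" by simp
        show ?thesis by (subst nn_integral_cmult_indicator) auto
      qed
      also have "\<dots> \<le> (\<integral>\<^sup>+y\<in>ball x R. ennreal (\<bar>u k y\<bar>\<^sup>2) \<partial>lborel)"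
      proof (intro nn_integral_mono)
        fix y
        have "t\<^sup>2 / 4 \<le> \<bar>u k y\<bar>\<^sup>2" if "\<bar>u k y\<bar> > t / 2"
          using power_mono[of "t / 2" "\<bar>u k y\<bar>" 2] that \<open>t > 0\<close> by (simp add: power_divide)
        then show "ennreal (t\<^sup>2 / 4) * indicator {y \<in> ball x r. \<bar>u k y\<bar> > t / 2} y
            \<le> ennreal (\<bar>u k y\<bar>\<^sup>2) * indicator (ball x R) y"
          using r by (auto simp: indicator_def r_def intro: ennreal_leI)
      qed
      also have "\<dots> \<le> (SUP y. \<integral>\<^sup>+x\<in>ball y R. ennreal (\<bar>u k x\<bar>\<^sup>2) \<partial>lborel)"
        by (rule SUP_upper) simp
      also have "\<dots> \<le> ennreal \<delta>" using elim by simp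
      finally have "emeasure lborel {y \<in> ball x r. \<bar>u k y\<bar> > t / 2} \<le> ennreal (\<delta> / (t\<^sup>2 / 4))"
        using \<open>t > 0\<close> \<open>\<delta> > 0\<close> by (intro ennreal_le_divideI) auto
      also have "\<delta> / (t\<^sup>2 / 4) = measure lborel (ball (0::'a) r) / 2"
        using \<open>t > 0\<close> by (simp add: \<delta>_def)
      finally show "emeasure lborel {y \<in> ball x r. \<bar>u k y\<bar> > t / 2} \<le> ennreal (measure lborel (ball (0::'a) r) / 2)" .
    qed (use r \<open>\<gamma> \<ge> 0\<close> \<open>t > 0\<close> in auto)
    also have "\<dots> \<le> ennreal \<epsilon>" using small by (rule ennreal_leI)
    finally show ?case using \<epsilon> by simp
  qed
qed simp

section \<open>From level sets to integrals\<close>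

lemma suminf_ennreal_tendsto_0:
  fixes L :: "nat \<Rightarrow> nat \<Rightarrow> ennreal" and a b :: "nat \<Rightarrow> real"
  assumes bound: "\<And>k j. L k j \<le> ennreal (b j)" and lim: "\<And>j. (\<lambda>k. L k j) \<longlonglongrightarrow> 0"
    and "\<And>j. a j \<ge> 0" "\<And>j. b j \<ge> 0" and summable: "summable (\<lambda>j. a j * b j)"
  shows "(\<lambda>k. \<Sum>j. ennreal (a j) * L k j) \<longlonglongrightarrow> 0"
proof -
  \<comment> \<open>Dominated convergence for the counting measure, with \<open>a j * b j\<close> as
    majorant.\<close>
  have "(\<lambda>k. \<integral>\<^sup>+j. ennreal (a j) * L k j \<partial>count_space UNIV) \<longlonglongrightarrow> (\<integral>\<^sup>+j. 0 \<partial>count_space (UNIV :: nat set))"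
  proof (rule nn_integral_dominated_convergence[where w="\<lambda>j. ennreal (a j * b j)"])
    show "AE j in count_space UNIV. ennreal (a j) * L k j \<le> ennreal (a j * b j)" for k
      using assms(3,4) by (auto intro!: AE_I2 mult_left_mono bound simp: ennreal_mult)
    show "(\<integral>\<^sup>+j. ennreal (a j * b j) \<partial>count_space UNIV) < \<infinity>"
      using summable assms(3,4)
      by (subst nn_integral_count_space_nat) (simp add: suminf_ennreal2)
    show "AE j in count_space UNIV. (\<lambda>k. ennreal (a j) * L k j) \<longlonglongrightarrow> 0"
      using ennreal_tendsto_cmult[OF _ lim] by (auto intro!: AE_I2)
  qed auto
  then show ?thesis by (simp add: nn_integral_count_space_nat)
qed

text \<open>For s > 0 a single term suffices. If 2^i < s \<le> 2^(i+1), the growth bound at the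
  endpoint 2^(i+1) is term i of the first sum when i \<ge> 0, and term -(i+1) of the second sum when
  i < 0.\<close>

lemma dyadic_bound:
  fixes m :: "real \<Rightarrow> real"
  assumes "A \<ge> 0" "p \<ge> 0" "q \<ge> 0" "s \<ge> 0"
    and large: "s \<ge> 1 \<Longrightarrow> m s \<le> A * s powr p" and small: "s \<le> 1 \<Longrightarrow> m s \<le> A * s powr q"
  shows "ennreal (m s)
    \<le> (\<Sum>j. ennreal (A * 2 powr ((real j + 1) * p)) * indicator {2 powr real j<..} s)
    + (\<Sum>j. ennreal (A * 2 powr (- real j * q)) * indicator {2 powr - (real j + 1)<..} s)"
proof (cases "s = 0")
  case True
  \<comment> \<open>Here \<open>0 powr q = 0\<close> makes the bound \<open>small\<close> read
    \<open>m 0 \<le> 0\<close>.\<close>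
  then have "m s \<le> 0" using small by simp
  then show ?thesis by (simp add: ennreal_neg)
next
  case False
  with \<open>s \<ge> 0\<close> have "s > 0" by simp
  \<comment> \<open>A ceiling minus one rather than a floor, so that 2^i < s is strict as the open
    half-lines require; s = 1 falls into the second sum.\<close>
  define i where "i = \<lceil>log 2 s\<rceil> - 1"
  have i: "2 powr i < s" "s \<le> 2 powr (i + 1)"
  proof -
    have "i < log 2 s" "log 2 s \<le> i + 1" unfolding i_def by linarith+
    then show "2 powr i < s" "s \<le> 2 powr (i + 1)"
      using \<open>s > 0\<close> by (simp_all add: less_log_iff log_le_iff)
  qed
  have term_le: "f j \<le> suminf f" for f :: "nat \<Rightarrow> ennreal" and j
    using sum_le_suminf[of f "{j}"] by simp
  show ?thesis
  proof (cases "s > 1")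
    case True
    then have "log 2 s > 0" using \<open>s > 0\<close> by simp
    then have "i \<ge> 0" unfolding i_def by linarith
    then obtain j where j: "i = int j" by (rule nonneg_int_cases)
    have "m s \<le> A * s powr p" using True by (intro large) simp
    also have "\<dots> \<le> A * (2 powr (i + 1)) powr p"
      using i \<open>s > 0\<close> assms by (intro mult_left_mono powr_mono2) auto
    finally have "ennreal (m s) \<le> ennreal (A * 2 powr ((real j + 1) * p)) * indicator {2 powr real j<..} s"
      using i by (auto simp: j powr_powr intro: ennreal_leI)
    also have "\<dots> \<le> (\<Sum>j. ennreal (A * 2 powr ((real j + 1) * p)) * indicator {2 powr real j<..} s)"
      by (rule term_le)
    finally show ?thesis by (rule order_trans) simp
  next
    case False
    then have "log 2 s \<le> 0" using \<open>s > 0\<close> by simp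
    then have "0 \<le> - (i + 1)" unfolding i_def by (simp add: ceiling_le_iff)
    then obtain j where j: "- (i + 1) = int j" by (rule nonneg_int_cases)
    then have j': "real_of_int i = - (real j + 1)" by linarith
    have "m s \<le> A * s powr q" using False by (intro small) simp
    also have "\<dots> \<le> A * (2 powr (i + 1)) powr q"
      using i \<open>s > 0\<close> assms by (intro mult_left_mono powr_mono2) auto
    finally have "ennreal (m s) \<le> ennreal (A * 2 powr (- real j * q)) * indicator {2 powr - (real j + 1)<..} s"
      using i by (auto simp: j' powr_powr intro: ennreal_leI)
    also have "\<dots> \<le> (\<Sum>j. ennreal (A * 2 powr (- real j * q)) * indicator {2 powr - (real j + 1)<..} s)"
      by (rule term_le)
    finally show ?thesis by (rule order_trans) simp
  qed
qed

lemma summable_two_powr: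
  fixes c d :: real
  assumes "c < 0"
  shows "summable (\<lambda>j. 2 powr (real j * c + d))"
proof -
  have "summable (\<lambda>j. 2 powr d * (2 powr c) ^ j)"
    using assms by (intro summable_mult summable_geometric) (simp add: powr_less_one)
  then show ?thesis
    by (simp add: powr_add powr_realpow[symmetric] powr_powr mult.commute)
qed

text \<open>Integrating the dyadic bound gives two series in the measures of superlevel sets. The
  weak bound majorizes them by geometric series of ratios 2^(p - c) and 2^(c - q), both below 1, so
  termwise convergence to 0 passes to the sums.\<close>

lemma nn_integral_tendsto_0_of_level_sets:
  fixes v :: "nat \<Rightarrow> 'a \<Rightarrow> real" and m :: "real \<Rightarrow> real"
  assumes [measurable]: "\<And>k. v k \<in> borel_measurable M"
    and weak: "\<And>k t. t > 0 \<Longrightarrow> emeasure M {x \<in> space M. \<bar>v k x\<bar> > t} \<le> ennreal (K * t powr - c)"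
    and lim: "\<And>t. t > 0 \<Longrightarrow> (\<lambda>k. emeasure M {x \<in> space M. \<bar>v k x\<bar> > t}) \<longlonglongrightarrow> 0"
    and "K \<ge> 0" "A \<ge> 0" "0 \<le> p" "p < c" "c < q"
    and large: "\<And>s. s \<ge> 1 \<Longrightarrow> m s \<le> A * s powr p"
    and small: "\<And>s. 0 \<le> s \<Longrightarrow> s \<le> 1 \<Longrightarrow> m s \<le> A * s powr q"
  shows "(\<lambda>k. \<integral>\<^sup>+x. ennreal (m \<bar>v k x\<bar>) \<partial>M) \<longlonglongrightarrow> 0"
proof -
  let ?L = "\<lambda>t k. emeasure M {x \<in> space M. \<bar>v k x\<bar> > t}"
  let ?S1 = "\<lambda>k. \<Sum>j. ennreal (A * 2 powr ((real j + 1) * p)) * ?L (2 powr real j) k"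
  let ?S2 = "\<lambda>k. \<Sum>j. ennreal (A * 2 powr (- real j * q)) * ?L (2 powr - (real j + 1)) k"
  have "?S1 \<longlonglongrightarrow> 0"
  proof (rule suminf_ennreal_tendsto_0[where b="\<lambda>j. K * (2 powr real j) powr - c"])
    have "summable (\<lambda>j. A * K * 2 powr (real j * (p - c) + p))"
      using assms by (intro summable_mult summable_two_powr) simp
    also have "(\<lambda>j. A * K * 2 powr (real j * (p - c) + p))
        = (\<lambda>j. A * 2 powr ((real j + 1) * p) * (K * (2 powr real j) powr - c))"
      by (simp add: powr_powr powr_add[symmetric] algebra_simps flip: powr_add)
    finally show "summable (\<lambda>j. A * 2 powr ((real j + 1) * p) * (K * (2 powr real j) powr - c))" .
  qed (use assms in \<open>auto intro!: weak lim\<close>)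
  moreover have "?S2 \<longlonglongrightarrow> 0"
  proof (rule suminf_ennreal_tendsto_0[where b="\<lambda>j. K * (2 powr - (real j + 1)) powr - c"])
    have "summable (\<lambda>j. A * K * 2 powr (real j * (c - q) + c))"
      using assms by (intro summable_mult summable_two_powr) simp
    also have "(\<lambda>j. A * K * 2 powr (real j * (c - q) + c))
        = (\<lambda>j. A * 2 powr (- real j * q) * (K * (2 powr - (real j + 1)) powr - c))"
      by (simp add: powr_powr powr_add[symmetric] algebra_simps flip: powr_add)
    finally show "summable (\<lambda>j. A * 2 powr (- real j * q) * (K * (2 powr - (real j + 1)) powr - c))" .
  qed (use assms in \<open>auto intro!: weak lim\<close>)
  ultimately have lim_sum: "(\<lambda>k. ?S1 k + ?S2 k) \<longlonglongrightarrow> 0"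
    by (intro tendsto_eq_intros) auto
  have bound: "(\<integral>\<^sup>+x. ennreal (m \<bar>v k x\<bar>) \<partial>M) \<le> ?S1 k + ?S2 k" for k
  proof -
    have eq: "(\<integral>\<^sup>+x. (\<Sum>j. ennreal (\<alpha> j) * indicator {\<tau> j<..} \<bar>v k x\<bar>) \<partial>M)
        = (\<Sum>j. ennreal (\<alpha> j) * ?L (\<tau> j) k)" for \<alpha> \<tau> :: "nat \<Rightarrow> real"
    proof (subst nn_integral_suminf)
      have "(\<integral>\<^sup>+x. ennreal (\<alpha> j) * indicator {\<tau> j<..} \<bar>v k x\<bar> \<partial>M)
          = (\<integral>\<^sup>+x. ennreal (\<alpha> j) * indicator {x \<in> space M. \<bar>v k x\<bar> > \<tau> j} x \<partial>M)" for j
        by (intro nn_integral_cong) (auto simp: indicator_def)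
      then show "(\<Sum>j. \<integral>\<^sup>+x. ennreal (\<alpha> j) * indicator {\<tau> j<..} \<bar>v k x\<bar> \<partial>M) = (\<Sum>j. ennreal (\<alpha> j) * ?L (\<tau> j) k)"
        by (simp add: nn_integral_cmult_indicator)
    qed simp
    have "(\<integral>\<^sup>+x. ennreal (m \<bar>v k x\<bar>) \<partial>M)
      \<le> (\<integral>\<^sup>+x. (\<Sum>j. ennreal (A * 2 powr ((real j + 1) * p)) * indicator {2 powr real j<..} \<bar>v k x\<bar>)
        + (\<Sum>j. ennreal (A * 2 powr (- real j * q)) * indicator {2 powr - (real j + 1)<..} \<bar>v k x\<bar>) \<partial>M)"
      using assms by (intro nn_integral_mono dyadic_bound) auto
    also have "\<dots> = ?S1 k + ?S2 k"
      by (subst nn_integral_add) (auto simp: eq)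
    finally show ?thesis .
  qed
  show ?thesis
    by (rule tendsto_sandwich[OF always_eventually always_eventually tendsto_const lim_sum])
      (simp, blast intro: bound)
qed

section \<open>Functions in \<open>D\<^sup>1\<^sup>,\<^sup>2\<close> and the nonlinearity\<close>

lemma lebesgue_ex_borel_measurable:
  fixes G :: "'a::euclidean_space \<Rightarrow> 'b::euclidean_space"
  assumes G: "G \<in> borel_measurable lebesgue"
  obtains G' where "G' \<in> borel_measurable borel" "AE x in lebesgue. G x = G' x"
proof -
  have "\<exists>g. g \<in> borel_measurable borel \<and> (AE x in lborel. G x \<bullet> i = g x)" for i
    using completion_ex_borel_measurable_real[of "\<lambda>x. G x \<bullet> i" lborel] G by auto
  then obtain g where g: "\<And>i. g i \<in> borel_measurable borel" "\<And>i. AE x in lborel. G x \<bullet> i = g i x"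
    by metis
  have "AE x in lborel. \<forall>i\<in>Basis. G x \<bullet> i = g i x"
    using g(2) by (intro AE_finite_allI) auto
  then have "AE x in lborel. G x = (\<Sum>i\<in>Basis. g i x *\<^sub>R i)"
    by eventually_elim (metis (no_types, lifting) euclidean_representation sum.cong)
  moreover have "(\<lambda>x. \<Sum>i\<in>Basis. g i x *\<^sub>R i) \<in> borel_measurable borel"
    using g(1) by measurable
  ultimately show ?thesis
    using that AE_completion by blast
qed

lemma locally_integrable_cong_AE:
  fixes g g' :: "'a::euclidean_space \<Rightarrow> 'b::euclidean_space"
  assumes "locally_integrable g" and [measurable]: "g \<in> borel_measurable lebesgue" "g' \<in> borel_measurable lebesgue"
    and ae: "AE x in lebesgue. g x = g' x"
  shows "locally_integrable g'"
  unfolding locally_integrable_def set_integrable_def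
proof (intro allI impI)
  fix K :: "'a set" assume K: "compact K"
  then have [measurable]: "K \<in> sets lebesgue" by (simp add: lmeasurable_compact fmeasurableD)
  have "integrable lebesgue (\<lambda>x. indicator K x *\<^sub>R g x)"
    using assms(1) K by (simp add: locally_integrable_def set_integrable_def)
  then show "integrable lebesgue (\<lambda>x. indicator K x *\<^sub>R g' x)"
  proof (rule integrable_cong_AE_imp)
    show "AE x in lebesgue. indicator K x *\<^sub>R g x = indicator K x *\<^sub>R g' x"
      using ae by eventually_elim simp
  qed simp
qed

lemma weak_gradient_cong_AE:
  fixes u u' :: "'a::euclidean_space \<Rightarrow> real"
  assumes wg: "weak_gradient u G"
    and [measurable]: "u \<in> borel_measurable lebesgue" "u' \<in> borel_measurable lebesgue"
      "G \<in> borel_measurable lebesgue" "G' \<in> borel_measurable lebesgue"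
    and ae: "AE x in lebesgue. u x = u' x" "AE x in lebesgue. G x = G' x"
  shows "weak_gradient u' G'"
  unfolding weak_gradient_def
proof (intro conjI allI impI ballI)
  show "locally_integrable u'" "locally_integrable G'"
    using locally_integrable_cong_AE[OF _ _ _ ae(1)] locally_integrable_cong_AE[OF _ _ _ ae(2)] wg
    by (simp_all add: weak_gradient_def)
  fix \<phi> :: "'a \<Rightarrow> real" and i :: 'a
  assume \<phi>: "test_function \<phi>" and i: "i \<in> Basis"
  have [measurable]: "\<phi> \<in> borel_measurable lebesgue" "(\<lambda>x. frechet_derivative \<phi> (at x) i) \<in> borel_measurable lebesgue"
    using test_function_continuous[OF \<phi>] test_function_derivative_continuous[OF \<phi>]
    by (auto intro!: measurable_completion borel_measurable_continuous_onI)
  have "(LINT x|lebesgue. u' x * frechet_derivative \<phi> (at x) i) = (LINT x|lebesgue. u x * frechet_derivative \<phi> (at x) i)"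
  proof (rule integral_cong_AE)
    show "AE x in lebesgue. u' x * frechet_derivative \<phi> (at x) i = u x * frechet_derivative \<phi> (at x) i"
      using ae(1) by eventually_elim simp
  qed simp_all
  moreover have "(LINT x|lebesgue. (G' x \<bullet> i) * \<phi> x) = (LINT x|lebesgue. (G x \<bullet> i) * \<phi> x)"
  proof (rule integral_cong_AE)
    show "AE x in lebesgue. (G' x \<bullet> i) * \<phi> x = (G x \<bullet> i) * \<phi> x"
      using ae(2) by eventually_elim simp
  qed simp_all
  ultimately show "(LINT x|lebesgue. u' x * frechet_derivative \<phi> (at x) i) = - (LINT x|lebesgue. (G' x \<bullet> i) * \<phi> x)"
    using wg \<phi> i by (simp add: weak_gradient_def)
qed

text \<open>The bound on increments was proved for Borel functions with a Borel weak gradient.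
  Replacing the chosen gradient by a Borel representative changes neither the weak identity nor its
  norm.\<close>

lemma D12_difference:
  fixes u v :: "'a::euclidean_space \<Rightarrow> real"
  assumes u: "u \<in> D12" and v: "v \<in> borel_measurable borel" and ae: "AE x in lebesgue. u x = v x"
  shows "(\<integral>\<^sup>+x. ennreal ((v (x + h) - v x)\<^sup>2) \<partial>lborel) \<le> ennreal ((norm h)\<^sup>2 * (D12_norm u)\<^sup>2)"
proof -
  define G where "G = D12_grad u"
  \<comment> \<open>Existence of a square integrable weak gradient makes the choice in
    \<open>D12_grad\<close> meaningful.\<close>
  have "\<exists>H. weak_gradient u H \<and> H \<in> Lp_space 2"
    using u unfolding D12_def mem_Collect_eq by (rule conjunct2)
  then have "weak_gradient u G \<and> G \<in> Lp_space 2"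
    unfolding G_def D12_grad_def by (rule someI_ex)
  then have wg: "weak_gradient u G" and Lp: "G \<in> Lp_space 2" by auto
  have G[measurable]: "G \<in> borel_measurable lebesgue" and "integrable lebesgue (\<lambda>x. norm (G x) powr 2)"
    using Lp by (auto simp: Lp_space_def)
  then have int: "integrable lebesgue (\<lambda>x. (norm (G x))\<^sup>2)"
    by simp
  obtain G' where G': "G' \<in> borel_measurable borel" "AE x in lebesgue. G x = G' x"
    using lebesgue_ex_borel_measurable[OF G] by blast
  have "weak_gradient v G'"
    using u v G' G by (intro weak_gradient_cong_AE[OF wg _ _ _ _ ae G'(2)])
      (auto simp: D12_def Lp_space_def intro: measurable_completion)
  then have "(\<integral>\<^sup>+x. ennreal ((v (x + h) - v x)\<^sup>2) \<partial>lborel)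
      \<le> ennreal ((norm h)\<^sup>2) * (\<integral>\<^sup>+x. ennreal ((norm (G' x))\<^sup>2) \<partial>lborel)"
    using v G'(1) by (rule weak_gradient_difference_quotient)
  also have "(\<integral>\<^sup>+x. ennreal ((norm (G' x))\<^sup>2) \<partial>lborel) = (\<integral>\<^sup>+x. ennreal ((norm (G' x))\<^sup>2) \<partial>lebesgue)"
    by (rule nn_integral_completion[symmetric])
  also have "\<dots> = (\<integral>\<^sup>+x. ennreal ((norm (G x))\<^sup>2) \<partial>lebesgue)"
    by (intro nn_integral_cong_AE, use G'(2) in eventually_elim) simp
  also have "\<dots> = ennreal ((D12_norm u)\<^sup>2)"
    using int by (subst nn_integral_eq_integral) (auto simp: D12_norm_def G_def)
  finally show ?thesis by (simp add: ennreal_mult)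
qed

section \<open>Measurability and growth of the nonlinearity\<close>

lemma C1_halfline_odd_extension_measurable:
  assumes "C1_halfline f f'"
  shows "odd_extension f \<in> borel_measurable borel"
proof -
  have "continuous_on {0..} f"
    using assms unfolding C1_halfline_def continuous_on_eq_continuous_within
    by (auto intro: DERIV_continuous)
  \<comment> \<open>Nothing is known of \<open>f\<close> on the negative axis; composing with
    \<open>max 0\<close> gives a continuous function on the whole line with the same values on the
    half-line.\<close>
  then have cont: "continuous_on UNIV (\<lambda>s. f (max 0 s))"
    by (rule continuous_on_compose2) (auto intro!: continuous_intros)
  then have [measurable]: "(\<lambda>s. f (max 0 s)) \<in> borel_measurable borel"
    by (rule borel_measurable_continuous_onI)
  then have [measurable]: "(\<lambda>s. f (max 0 (- s))) \<in> borel_measurable borel"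
    by (rule measurable_compose_rev) simp
  have "odd_extension f = (\<lambda>s. if s < 0 then - f (max 0 (- s)) else f (max 0 s))"
    by (auto simp: odd_extension_def fun_eq_iff)
  then show ?thesis by simp
qed

lemma f1_odd_extension_bounds:
  assumes "f1 N f f'"
  obtains A p q where "A > 0" "2 < p" "p < crit_exp N" "crit_exp N < q"
    and "\<And>s. \<bar>s\<bar> \<ge> 1 \<Longrightarrow> \<bar>odd_extension f s * s\<bar> \<le> A * \<bar>s\<bar> powr p"
    and "\<And>s. \<bar>s\<bar> \<le> 1 \<Longrightarrow> \<bar>odd_extension f s * s\<bar> \<le> A * \<bar>s\<bar> powr q"
proof -
  from assms obtain A p q where Apq: "A > 0" "2 < p" "p < crit_exp N" "crit_exp N < q"
    and f: "\<And>s. s \<ge> 0 \<Longrightarrow> (\<bar>s\<bar> \<ge> 1 \<longrightarrow> \<bar>f s\<bar> \<le> A * \<bar>s\<bar> powr (p - 1)) \<and> (\<bar>s\<bar> \<le> 1 \<longrightarrow> \<bar>f s\<bar> \<le> A * \<bar>s\<bar> powr (q - 1))"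
    unfolding f1_def by auto
  have eq: "\<bar>odd_extension f s * s\<bar> = \<bar>f \<bar>s\<bar>\<bar> * \<bar>s\<bar>" for s
    by (auto simp: odd_extension_def abs_mult)
  \<comment> \<open>This includes s = 0, where both sides are 0.\<close>
  have mult: "A * \<bar>s\<bar> powr (e - 1) * \<bar>s\<bar> = A * \<bar>s\<bar> powr e" for s e :: real
    by (simp add: powr_diff)
  show ?thesis
  proof (rule that[OF Apq])
    show "\<bar>odd_extension f s * s\<bar> \<le> A * \<bar>s\<bar> powr p" if "\<bar>s\<bar> \<ge> 1" for s
      using mult_right_mono[of "\<bar>f \<bar>s\<bar>\<bar>" "A * \<bar>s\<bar> powr (p - 1)" "\<bar>s\<bar>"] f[of "\<bar>s\<bar>"] that
      by (simp add: eq mult)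
    show "\<bar>odd_extension f s * s\<bar> \<le> A * \<bar>s\<bar> powr q" if "\<bar>s\<bar> \<le> 1" for s
      using mult_right_mono[of "\<bar>f \<bar>s\<bar>\<bar>" "A * \<bar>s\<bar> powr (q - 1)" "\<bar>s\<bar>"] f[of "\<bar>s\<bar>"] that
      by (simp add: eq mult)
  qed
qed

text \<open>The Bochner integral of a non-integrable function is 0 by convention, so integrability
  is asserted along with the limit. The supremum in the vanishing hypothesis is taken in
  \<open>ennreal\<close>, where it always exists.\<close>

theorem lemma3p5:
  fixes f f' :: "real \<Rightarrow> real" and u :: "nat \<Rightarrow> real ^ 'n \<Rightarrow> real" and R :: real
  assumes "CARD('n) \<ge> 3"
    and "f1 CARD('n) f f'" and "f2 f f'" and "f3 CARD('n) f f'"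
    and "\<And>k. u k \<in> D12" and "\<exists>C. \<forall>k. D12_norm (u k) \<le> C"
    and "R > 0"
    and "(\<lambda>k. SUP y. \<integral>\<^sup>+x\<in>ball y R. ennreal (\<bar>u k x\<bar>\<^sup>2) \<partial>lebesgue) \<longlonglongrightarrow> 0"
  shows "(\<forall>k. integrable lebesgue (\<lambda>x. odd_extension f (u k x) * u k x)) \<and>
    (\<lambda>k. LINT x|lebesgue. odd_extension f (u k x) * u k x) \<longlonglongrightarrow> 0"
proof -
  define c where "c = crit_exp CARD('n)"
  define F where "F s = odd_extension f s * s" for s
  obtain A p q where Apq: "A > 0" "2 < p" "p < c" "c < q"
    and large: "\<And>s. \<bar>s\<bar> \<ge> 1 \<Longrightarrow> \<bar>F s\<bar> \<le> A * \<bar>s\<bar> powr p"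
    and small: "\<And>s. \<bar>s\<bar> \<le> 1 \<Longrightarrow> \<bar>F s\<bar> \<le> A * \<bar>s\<bar> powr q"
    unfolding c_def F_def using f1_odd_extension_bounds[OF assms(2)] by metis
  have [measurable]: "F \<in> borel_measurable borel"
    using C1_halfline_odd_extension_measurable[of f f'] assms(2) unfolding F_def f1_def by auto
  \<comment> \<open>As p < c < q, both growth bounds are dominated by the critical power, so
    membership of u in L^c gives integrability of F(u).\<close>
  have F_bound: "\<bar>F s\<bar> \<le> A * \<bar>s\<bar> powr c" for s
  proof (cases "\<bar>s\<bar> \<ge> 1")
    case True
    then have "\<bar>s\<bar> powr p \<le> \<bar>s\<bar> powr c" using Apq by (intro powr_mono) auto
    then show ?thesis using large[OF True] Apq by (meson mult_left_mono less_imp_le order_trans)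
  next
    case False
    then have "\<bar>s\<bar> powr q \<le> \<bar>s\<bar> powr c"
      using Apq by (intro powr_mono') auto
    then show ?thesis using small[of s] False Apq by (meson mult_left_mono less_imp_le order_trans linear)
  qed
  have u[measurable]: "u k \<in> borel_measurable lebesgue" and u_int: "integrable lebesgue (\<lambda>x. \<bar>u k x\<bar> powr c)" for k
    using assms(5)[of k] by (auto simp: D12_def Lp_space_def c_def)
  have int: "integrable lebesgue (\<lambda>x. F (u k x))" for k
    by (rule Bochner_Integration.integrable_bound[OF integrable_mult_right[OF u_int[of k], of A]])
      (use Apq F_bound in \<open>auto simp: abs_mult\<close>)
  have "\<exists>w. w \<in> borel_measurable borel \<and> (AE x in lebesgue. u k x = w x)" for k
    using lebesgue_ex_borel_measurable[OF u[of k]] by metis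
  then obtain v where v[measurable]: "\<And>k. v k \<in> borel_measurable borel" and ae: "\<And>k. AE x in lebesgue. u k x = v k x"
    by metis
  \<comment> \<open>The integrand may depend on the point as well as on the value, so that integrals
    over balls are covered too.\<close>
  have transfer: "(\<integral>\<^sup>+x. h x (u k x) \<partial>lebesgue) = (\<integral>\<^sup>+x. h x (v k x) \<partial>lborel)" for h k
  proof -
    have "(\<integral>\<^sup>+x. h x (u k x) \<partial>lebesgue) = (\<integral>\<^sup>+x. h x (v k x) \<partial>lebesgue)"
      by (intro nn_integral_cong_AE, use ae[of k] in eventually_elim) simp
    then show ?thesis by (simp add: nn_integral_completion)
  qed
  obtain C where C: "\<And>k. D12_norm (u k) \<le> C" using assms(6) by blast
  have norm0: "0 \<le> D12_norm (u k)" for k by (simp add: D12_norm_def)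
  have diff: "(\<integral>\<^sup>+x. ennreal ((v k (x + h) - v k x)\<^sup>2) \<partial>lborel) \<le> ennreal ((norm h)\<^sup>2 * C\<^sup>2)" for k h
    using D12_difference[OF assms(5) v ae, of k h] C[of k] norm0[of k]
    by (elim order_trans) (intro ennreal_leI mult_left_mono power_mono, auto)
  have v_int: "integrable lborel (\<lambda>x. \<bar>v k x\<bar> powr c)" for k
  proof -
    have "integrable lebesgue (\<lambda>x. \<bar>v k x\<bar> powr c)"
    proof (rule integrable_cong_AE_imp[OF u_int[of k]])
      show "AE x in lebesgue. \<bar>u k x\<bar> powr c = \<bar>v k x\<bar> powr c"
        using ae[of k] by eventually_elim simp
    qed (intro measurable_completion, simp)
    then show ?thesis by (subst (asm) integrable_completion) auto
  qed
  \<comment> \<open>The constant of the weak Sobolev inequality involves only the dimension and the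
    common gradient bound \<open>C\<close>, hence is the same for all k.\<close>
  obtain K where "K \<ge> 0" and weak: "\<And>k t. t > 0 \<Longrightarrow> emeasure lborel {x. \<bar>v k x\<bar> > t} \<le> ennreal (K * t powr - c)"
  proof
    show "0 \<le> (8 * C\<^sup>2 * (2 powr (1 + c) / unit_ball_vol CARD('n)) powr (2 / CARD('n))) powr (CARD('n) / (real CARD('n) - 2))"
      by simp
    show "emeasure lborel {x. \<bar>v k x\<bar> > t} \<le> ennreal
       ((8 * C\<^sup>2 * (2 powr (1 + c) / unit_ball_vol CARD('n)) powr (2 / CARD('n))) powr (CARD('n) / (real CARD('n) - 2)) * t powr - c)"
      if "t > 0" for k t
      using weak_sobolev_inequality[of "v k" "C\<^sup>2" t] assms(1) diff v_int that by (simp add: c_def)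
  qed
  have "(\<integral>\<^sup>+x\<in>ball y R. ennreal (\<bar>u k x\<bar>\<^sup>2) \<partial>lebesgue) = (\<integral>\<^sup>+x\<in>ball y R. ennreal (\<bar>v k x\<bar>\<^sup>2) \<partial>lborel)" for k y
    by (rule transfer)
  with assms(8) have "(\<lambda>k. SUP y. \<integral>\<^sup>+x\<in>ball y R. ennreal (\<bar>v k x\<bar>\<^sup>2) \<partial>lborel) \<longlonglongrightarrow> 0"
    by (simp only:)
  then have lim: "(\<lambda>k. emeasure lborel {x. \<bar>v k x\<bar> > t}) \<longlonglongrightarrow> 0" if "t > 0" for t
    using v diff assms(7) that by (intro level_sets_vanish[where \<gamma>="C\<^sup>2" and R=R]) auto
  have "(\<lambda>k. \<integral>\<^sup>+x. ennreal \<bar>F \<bar>v k x\<bar>\<bar> \<partial>lborel) \<longlonglongrightarrow> 0"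
  proof (rule nn_integral_tendsto_0_of_level_sets[where K=K and c=c and A=A and p=p and q=q and m="\<lambda>s. \<bar>F s\<bar>"])
    show "\<bar>F s\<bar> \<le> A * s powr p" if "s \<ge> 1" for s
      using large[of s] that by simp
    show "\<bar>F s\<bar> \<le> A * s powr q" if "0 \<le> s" "s \<le> 1" for s
      using small[of s] that by simp
  qed (use weak lim Apq \<open>K \<ge> 0\<close> in auto)
  \<comment> \<open>\<open>F\<close> is even, being the product of the odd extension and s, so
    evaluating it at the modulus changes nothing.\<close>
  moreover have "(\<integral>\<^sup>+x. ennreal \<bar>F \<bar>v k x\<bar>\<bar> \<partial>lborel) = (\<integral>\<^sup>+x. ennreal (norm (F (u k x))) \<partial>lebesgue)" for k
    by (subst transfer[of "\<lambda>_ s. ennreal (norm (F s))"])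
      (auto intro!: nn_integral_cong simp: F_def odd_extension_def abs_mult abs_if)
  ultimately have "(\<lambda>k. \<integral>\<^sup>+x. ennreal (norm (F (u k x))) \<partial>lebesgue) \<longlonglongrightarrow> 0"
    by simp
  then have "(\<lambda>k. ennreal (norm (LINT x|lebesgue. F (u k x)))) \<longlonglongrightarrow> ennreal 0"
    unfolding ennreal_0
    by (rule tendsto_sandwich[OF always_eventually always_eventually tendsto_const, rotated 2])
      (use integral_norm_bound_ennreal[OF int] in auto)
  then have "(\<lambda>k. norm (LINT x|lebesgue. F (u k x))) \<longlonglongrightarrow> 0"
    by (rule tendsto_ennrealD) auto
  then have "(\<lambda>k. LINT x|lebesgue. F (u k x)) \<longlonglongrightarrow> 0"
    by (rule tendsto_norm_zero_cancel)
  with int show ?thesis by (simp add: F_def)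
qed

end
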